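(* Let $U\subset\mathbb{R}^2$ be open and let $[\Gamma]$ be a projective structure on $U$ whose coefficient functions $A_0,A_1,A_2,A_3$ have continuous derivatives up to order five. If $[\Gamma]$ is metrisable (in a neighbourhood of every point of $U$), then $$\det\big(\mathcal{M}([\Gamma])\big)=0$$ identically on $U$, where $\mathcal{M}([\Gamma])$ is the $6\times 6$ matrix with rows $\mathbf V,\ D_1\mathbf V,\ D_2\mathbf V,\ D_{(1}D_{1)}\mathbf V,\ D_{(1}D_{2)}\mathbf V,\ D_{(2}D_{2)}\mathbf V$ defined in the context.
   Context: Coordinates on $U$ are $(x^1,x^2)=(x,y)$; $\partial_1=\partial_x$, $\partial_2=\partial_y$. A projective structure $[\Gamma]$ on $U$ is an equivalence class of torsion-free connections, where $\Gamma\sim\hat\Gamma$ iff they have the same unparametrised geodesics, i.e. $\hat\Gamma^c_{ab}=\Gamma^c_{ab}+\delta^c_a\omega_b+\delta^c_b\omega_a$ for some one-form $\omega$. $[\Gamma]$ is metrisable in a neighbourhood of $p\in U$ if on some neighbourhood of $p$ there is a metric $g$ (symmetric, non-degenerate, of any signature) whose Levi-Civita connection belongs to $[\Gamma]$. The functions $$A_3=\Gamma^1_{22},\quad A_2=2\Gamma^1_{12}-\Gamma^2_{22},\quad A_1=\Gamma^1_{11}-2\Gamma^2_{12},\quad A_0=-\Gamma^2_{11}$$ depend only on $[\Gamma]$ and determine it (the unparametrised geodesics are the integral curves of $y''=A_3(y')^3+A_2(y')^2+A_1y'+A_0$). Liouville expressions: $L_1=\frac23\partial_x\partial_yA_1-\frac13\partial_x^2A_2-\partial_y^2A_0+A_0\partial_yA_2+A_2\partial_yA_0-A_3\partial_xA_0-2A_0\partial_xA_3-\frac23A_1\partial_yA_1+\frac13A_1\partial_xA_2$,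 $L_2=\frac23\partial_x\partial_yA_2-\frac13\partial_y^2A_1-\partial_x^2A_3-A_3\partial_xA_1-A_1\partial_xA_3+A_0\partial_yA_3+2A_3\partial_yA_0+\frac23A_2\partial_xA_2-\frac13A_2\partial_yA_1$. The row vector $\mathbf V=(V_1,\dots,V_6)$: $V_1=2\partial_yL_2+4A_2L_2+8A_3L_1$, $V_2=-2\partial_yL_1-2\partial_xL_2-\frac43A_1L_2+\frac43A_2L_1$, $V_3=2\partial_xL_1-8A_0L_2-4A_1L_1$, $V_4=-5L_2$, $V_5=-5L_1$, $V_6=0$. The $6\times6$ matrices $\mathbf\Omega_1,\mathbf\Omega_2$: $$\mathbf\Omega_1=\begin{pmatrix} -\frac23A_1&2A_0&0&0&0&0 \\ 0&0&0&-\frac12&0&0 \\ -2A_3&-\frac23A_2&\frac43A_1&0&1&0 \\ {a_{41}}&a_{42}&a_{43}&-\frac13A_1&-3A_0&0 \\ 0&0&0&0&0&-1 \\ {a_{61}}&a_{62}&a_{63}&a_{64}&a_{65}&-\frac13A_1 \end{pmatrix},\quad \mathbf\Omega_2=\begin{pmatrix} -\frac43A_2&\frac23A_1&2A_0&1&0&0 \\ 0&0&0&0&-\frac12&0 \\ 0&-2A_3&\frac23A_2&0&0&0 \\ 0&0&0&0&0&-1 \\ {b_{51}}&b_{52}&b_{53}&3A_3&\frac13A_2&0 \\ {b_{61}}&b_{62}&b_{63}&b_{64}&b_{65}&\frac13A_2 \end{pmatrix}$$ with $a_{41}=-\frac43\partial_xA_2+4A_0A_3+\frac23\partial_yA_1$;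 $a_{42}=-2\partial_yA_0+\frac23\partial_xA_1+4A_2A_0-\frac49A_1^2$; $a_{43}=2\partial_xA_0-4A_0A_1$; $a_{61}=-\frac43\partial_x\partial_yA_2-\frac{20}3A_0A_2A_3+\frac23\partial_y^2A_1+4A_3\partial_yA_0-2A_0\partial_yA_3-\frac{16}9A_2\partial_xA_2+\frac89A_2\partial_yA_1$; $a_{62}=\frac23\partial_x\partial_yA_1-\frac43A_1\partial_yA_1+2A_0\partial_yA_2-2\partial_y^2A_0+4A_2\partial_yA_0+4A_3\partial_xA_0+6A_0\partial_xA_3+\frac89A_1\partial_xA_2+\frac43A_0A_1A_3-\frac43A_0A_2^2$; $a_{63}=2\partial_x\partial_yA_0+\frac23A_0\partial_xA_2-\frac43A_2\partial_xA_0-4A_1\partial_yA_0-\frac43A_0\partial_yA_1+\frac83A_0A_1A_2+4A_3A_0^2$; $a_{64}=\frac43\partial_xA_2-\partial_yA_1+5A_0A_3$; $a_{65}=\frac13\partial_xA_1-4\partial_yA_0+3A_2A_0-\frac29A_1^2$; $b_{51}=-2\partial_yA_3-4A_3A_2$; $b_{52}=2\partial_xA_3-\frac23\partial_yA_2+4A_1A_3-\frac49A_2^2$; $b_{53}=\frac43\partial_yA_1-\frac23\partial_xA_2+4A_0A_3$; $b_{61}=-2\partial_x\partial_yA_3-4A_2\partial_xA_3-\frac43A_3\partial_xA_2+\frac23A_3\partial_yA_1-\frac43A_1\partial_yA_3-4A_0A_3^2-\frac83A_1A_2A_3$; $b_{62}=2\partial_x^2A_3-\frac43A_2\partial_xA_2-\frac43A_0A_2A_3-\frac23\partial_x\partial_yA_2+4A_1\partial_xA_3+4A_0\partial_yA_3+6A_3\partial_yA_0+\frac43A_3A_1^2+2A_3\partial_xA_1+\frac89A_2\partial_yA_1$;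 $b_{63}=-\frac23\partial_x^2A_2+\frac89A_1\partial_xA_2+4A_0\partial_xA_3-2A_3\partial_xA_0-\frac{16}9A_1\partial_yA_1+\frac43\partial_x\partial_yA_1+\frac{20}3A_0A_1A_3$; $b_{64}=4\partial_xA_3-\frac13\partial_yA_2+3A_1A_3-\frac29A_2^2$; $b_{65}=\partial_xA_2-\frac43\partial_yA_1+5A_0A_3$. For a row-vector valued function $\mathbf W:U\to\mathbb{R}^6$ set $D_a\mathbf W=\partial_a\mathbf W-\mathbf W\,\mathbf\Omega_a$ ($a=1,2$), iterated: $D_aD_b\mathbf V=\partial_a(D_b\mathbf V)-(D_b\mathbf V)\mathbf\Omega_a$. Round brackets around indices denote symmetrisation. The entries of $\mathcal M([\Gamma])$ involve the $A_\alpha$ and their derivatives up to order five. *)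

theory Defs
  imports "HOL-Analysis.Analysis"
begin

definition partial :: "2 \<Rightarrow> (real^2 \<Rightarrow> 'a::real_normed_vector) \<Rightarrow> real^2 \<Rightarrow> 'a" where
  "partial a f p = frechet_derivative f (at p) (axis a 1)"

abbreviation partial_x ("\<partial>\<^sub>x") where "\<partial>\<^sub>x \<equiv> partial 1"
abbreviation partial_y ("\<partial>\<^sub>y") where "\<partial>\<^sub>y \<equiv> partial 2"

text \<open>Continuous partial derivatives up to order \<open>k\<close>; only meant for open sets, where
  existence and continuity of the partials is the same as Frechet \<open>C\<^sup>k\<close>.\<close>
primrec Ck_on :: "nat \<Rightarrow> (real^2 \<Rightarrow> real) \<Rightarrow> (real^2) set \<Rightarrow> bool" where
  "Ck_on 0 f U \<longleftrightarrow> continuous_on U f"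
| "Ck_on (Suc k) f U \<longleftrightarrow>
     (\<forall>p\<in>U. f differentiable (at p)) \<and> (\<forall>a. Ck_on k (partial a f) U)"

text \<open>A connection is given by its components: \<open>\<Gamma> p c a b\<close> is \<open>\<Gamma>\<^sup>c\<^sub>a\<^sub>b\<close> at \<open>p\<close>.
  No regularity is built in; it is imposed on the coefficient functions below, which
  are all that the projective structure depends on.\<close>
type_synonym connection = "real^2 \<Rightarrow> 2 \<Rightarrow> 2 \<Rightarrow> 2 \<Rightarrow> real"

definition torsion_free_on :: "(real^2) set \<Rightarrow> connection \<Rightarrow> bool" where
  "torsion_free_on U \<Gamma> \<longleftrightarrow> (\<forall>p\<in>U. \<forall>a b c. \<Gamma> p c a b = \<Gamma> p c b a)"

definition kronecker :: "2 \<Rightarrow> 2 \<Rightarrow> real" where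
  "kronecker c a = (if c = a then 1 else 0)"

definition projectively_equivalent_on ::
    "(real^2) set \<Rightarrow> connection \<Rightarrow> connection \<Rightarrow> bool" where
  "projectively_equivalent_on U \<Gamma> \<Gamma>' \<longleftrightarrow>
     (\<exists>\<omega> :: real^2 \<Rightarrow> real^2. \<forall>p\<in>U. \<forall>a b c.
        \<Gamma>' p c a b = \<Gamma> p c a b + kronecker c a * \<omega> p $ b + kronecker c b * \<omega> p $ a)"

definition projective_class :: "(real^2) set \<Rightarrow> connection \<Rightarrow> connection set" where
  "projective_class U \<Gamma> =
     {\<Gamma>'. torsion_free_on U \<Gamma>' \<and> projectively_equivalent_on U \<Gamma> \<Gamma>'}"

text \<open>\<open>C\<^sup>1\<close> is what is needed for the Levi-Civita connection to be a (continuous) connection.\<close>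
definition metric_on :: "(real^2) set \<Rightarrow> (real^2 \<Rightarrow> real^2^2) \<Rightarrow> bool" where
  "metric_on U g \<longleftrightarrow>
     (\<forall>a b. Ck_on 1 (\<lambda>p. g p $ a $ b) U) \<and>
     (\<forall>p\<in>U. transpose (g p) = g p \<and> det (g p) \<noteq> 0)"

definition levi_civita :: "(real^2 \<Rightarrow> real^2^2) \<Rightarrow> connection" where
  "levi_civita g p c a b =
     (1/2) * (\<Sum>d\<in>UNIV. matrix_inv (g p) $ c $ d *
        (partial a (\<lambda>q. g q $ b $ d) p + partial b (\<lambda>q. g q $ a $ d) p
         - partial d (\<lambda>q. g q $ a $ b) p))"

definition metrisable_near :: "(real^2) set \<Rightarrow> connection \<Rightarrow> real^2 \<Rightarrow> bool" where
  "metrisable_near U \<Gamma> p \<longleftrightarrow>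
     (\<exists>N g. open N \<and> p \<in> N \<and> N \<subseteq> U \<and> metric_on N g \<and>
        levi_civita g \<in> projective_class N \<Gamma>)"

text \<open>Companion of \<open>vector_3\<close>: the list is read in order, with \<open>6 = 0\<close> as last index.\<close>
lemma vector_6:
 "(vector [a,b,c,d,e,f] :: ('a::zero)^6) $ 1 = a"
 "(vector [a,b,c,d,e,f] :: ('a::zero)^6) $ 2 = b"
 "(vector [a,b,c,d,e,f] :: ('a::zero)^6) $ 3 = c"
 "(vector [a,b,c,d,e,f] :: ('a::zero)^6) $ 4 = d"
 "(vector [a,b,c,d,e,f] :: ('a::zero)^6) $ 5 = e"
 "(vector [a,b,c,d,e,f] :: ('a::zero)^6) $ 6 = f"
  unfolding vector_def by simp_all

context
  fixes \<Gamma> :: connection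
begin

definition A3 :: "real^2 \<Rightarrow> real" where "A3 p = \<Gamma> p 1 2 2"
definition A2 :: "real^2 \<Rightarrow> real" where "A2 p = 2 * \<Gamma> p 1 1 2 - \<Gamma> p 2 2 2"
definition A1 :: "real^2 \<Rightarrow> real" where "A1 p = \<Gamma> p 1 1 1 - 2 * \<Gamma> p 2 1 2"
definition A0 :: "real^2 \<Rightarrow> real" where "A0 p = - \<Gamma> p 2 1 1"

definition L1 :: "real^2 \<Rightarrow> real" where
  "L1 p = 2/3 * \<partial>\<^sub>x (\<partial>\<^sub>y A1) p - 1/3 * \<partial>\<^sub>x (\<partial>\<^sub>x A2) p - \<partial>\<^sub>y (\<partial>\<^sub>y A0) p
     + A0 p * \<partial>\<^sub>y A2 p + A2 p * \<partial>\<^sub>y A0 p - A3 p * \<partial>\<^sub>x A0 p - 2 * A0 p * \<partial>\<^sub>x A3 p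
     - 2/3 * A1 p * \<partial>\<^sub>y A1 p + 1/3 * A1 p * \<partial>\<^sub>x A2 p"

definition L2 :: "real^2 \<Rightarrow> real" where
  "L2 p = 2/3 * \<partial>\<^sub>x (\<partial>\<^sub>y A2) p - 1/3 * \<partial>\<^sub>y (\<partial>\<^sub>y A1) p - \<partial>\<^sub>x (\<partial>\<^sub>x A3) p
     - A3 p * \<partial>\<^sub>x A1 p - A1 p * \<partial>\<^sub>x A3 p + A0 p * \<partial>\<^sub>y A3 p + 2 * A3 p * \<partial>\<^sub>y A0 p
     + 2/3 * A2 p * \<partial>\<^sub>x A2 p - 1/3 * A2 p * \<partial>\<^sub>y A1 p"

definition \<V> :: "real^2 \<Rightarrow> real^6" where
  "\<V> p = vector
    [2 * \<partial>\<^sub>y L2 p + 4 * A2 p * L2 p + 8 * A3 p * L1 p,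
     - 2 * \<partial>\<^sub>y L1 p - 2 * \<partial>\<^sub>x L2 p - 4/3 * A1 p * L2 p + 4/3 * A2 p * L1 p,
     2 * \<partial>\<^sub>x L1 p - 8 * A0 p * L2 p - 4 * A1 p * L1 p,
     - 5 * L2 p,
     - 5 * L1 p,
     0]"

definition a41 :: "real^2 \<Rightarrow> real" where
  "a41 p = - 4/3 * \<partial>\<^sub>x A2 p + 4 * A0 p * A3 p + 2/3 * \<partial>\<^sub>y A1 p"
definition a42 :: "real^2 \<Rightarrow> real" where
  "a42 p = - 2 * \<partial>\<^sub>y A0 p + 2/3 * \<partial>\<^sub>x A1 p + 4 * A2 p * A0 p - 4/9 * (A1 p)^2"
definition a43 :: "real^2 \<Rightarrow> real" where
  "a43 p = 2 * \<partial>\<^sub>x A0 p - 4 * A0 p * A1 p"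
definition a61 :: "real^2 \<Rightarrow> real" where
  "a61 p = - 4/3 * \<partial>\<^sub>x (\<partial>\<^sub>y A2) p - 20/3 * A0 p * A2 p * A3 p + 2/3 * \<partial>\<^sub>y (\<partial>\<^sub>y A1) p
     + 4 * A3 p * \<partial>\<^sub>y A0 p - 2 * A0 p * \<partial>\<^sub>y A3 p - 16/9 * A2 p * \<partial>\<^sub>x A2 p
     + 8/9 * A2 p * \<partial>\<^sub>y A1 p"
definition a62 :: "real^2 \<Rightarrow> real" where
  "a62 p = 2/3 * \<partial>\<^sub>x (\<partial>\<^sub>y A1) p - 4/3 * A1 p * \<partial>\<^sub>y A1 p + 2 * A0 p * \<partial>\<^sub>y A2 p
     - 2 * \<partial>\<^sub>y (\<partial>\<^sub>y A0) p + 4 * A2 p * \<partial>\<^sub>y A0 p + 4 * A3 p * \<partial>\<^sub>x A0 p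
     + 6 * A0 p * \<partial>\<^sub>x A3 p + 8/9 * A1 p * \<partial>\<^sub>x A2 p + 4/3 * A0 p * A1 p * A3 p
     - 4/3 * A0 p * (A2 p)^2"
definition a63 :: "real^2 \<Rightarrow> real" where
  "a63 p = 2 * \<partial>\<^sub>x (\<partial>\<^sub>y A0) p + 2/3 * A0 p * \<partial>\<^sub>x A2 p - 4/3 * A2 p * \<partial>\<^sub>x A0 p
     - 4 * A1 p * \<partial>\<^sub>y A0 p - 4/3 * A0 p * \<partial>\<^sub>y A1 p + 8/3 * A0 p * A1 p * A2 p
     + 4 * A3 p * (A0 p)^2"
definition a64 :: "real^2 \<Rightarrow> real" where
  "a64 p = 4/3 * \<partial>\<^sub>x A2 p - \<partial>\<^sub>y A1 p + 5 * A0 p * A3 p"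
definition a65 :: "real^2 \<Rightarrow> real" where
  "a65 p = 1/3 * \<partial>\<^sub>x A1 p - 4 * \<partial>\<^sub>y A0 p + 3 * A2 p * A0 p - 2/9 * (A1 p)^2"

definition b51 :: "real^2 \<Rightarrow> real" where
  "b51 p = - 2 * \<partial>\<^sub>y A3 p - 4 * A3 p * A2 p"
definition b52 :: "real^2 \<Rightarrow> real" where
  "b52 p = 2 * \<partial>\<^sub>x A3 p - 2/3 * \<partial>\<^sub>y A2 p + 4 * A1 p * A3 p - 4/9 * (A2 p)^2"
definition b53 :: "real^2 \<Rightarrow> real" where
  "b53 p = 4/3 * \<partial>\<^sub>y A1 p - 2/3 * \<partial>\<^sub>x A2 p + 4 * A0 p * A3 p"
definition b61 :: "real^2 \<Rightarrow> real" where
  "b61 p = - 2 * \<partial>\<^sub>x (\<partial>\<^sub>y A3) p - 4 * A2 p * \<partial>\<^sub>x A3 p - 4/3 * A3 p * \<partial>\<^sub>x A2 p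
     + 2/3 * A3 p * \<partial>\<^sub>y A1 p - 4/3 * A1 p * \<partial>\<^sub>y A3 p - 4 * A0 p * (A3 p)^2
     - 8/3 * A1 p * A2 p * A3 p"
definition b62 :: "real^2 \<Rightarrow> real" where
  "b62 p = 2 * \<partial>\<^sub>x (\<partial>\<^sub>x A3) p - 4/3 * A2 p * \<partial>\<^sub>x A2 p - 4/3 * A0 p * A2 p * A3 p
     - 2/3 * \<partial>\<^sub>x (\<partial>\<^sub>y A2) p + 4 * A1 p * \<partial>\<^sub>x A3 p + 4 * A0 p * \<partial>\<^sub>y A3 p
     + 6 * A3 p * \<partial>\<^sub>y A0 p + 4/3 * A3 p * (A1 p)^2 + 2 * A3 p * \<partial>\<^sub>x A1 p
     + 8/9 * A2 p * \<partial>\<^sub>y A1 p"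
definition b63 :: "real^2 \<Rightarrow> real" where
  "b63 p = - 2/3 * \<partial>\<^sub>x (\<partial>\<^sub>x A2) p + 8/9 * A1 p * \<partial>\<^sub>x A2 p + 4 * A0 p * \<partial>\<^sub>x A3 p
     - 2 * A3 p * \<partial>\<^sub>x A0 p - 16/9 * A1 p * \<partial>\<^sub>y A1 p + 4/3 * \<partial>\<^sub>x (\<partial>\<^sub>y A1) p
     + 20/3 * A0 p * A1 p * A3 p"
definition b64 :: "real^2 \<Rightarrow> real" where
  "b64 p = 4 * \<partial>\<^sub>x A3 p - 1/3 * \<partial>\<^sub>y A2 p + 3 * A1 p * A3 p - 2/9 * (A2 p)^2"
definition b65 :: "real^2 \<Rightarrow> real" where
  "b65 p = \<partial>\<^sub>x A2 p - 4/3 * \<partial>\<^sub>y A1 p + 5 * A0 p * A3 p"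

definition \<Omega>1 :: "real^2 \<Rightarrow> real^6^6" where
  "\<Omega>1 p = vector
    [vector [- 2/3 * A1 p, 2 * A0 p, 0, 0, 0, 0],
     vector [0, 0, 0, - 1/2, 0, 0],
     vector [- 2 * A3 p, - 2/3 * A2 p, 4/3 * A1 p, 0, 1, 0],
     vector [a41 p, a42 p, a43 p, - 1/3 * A1 p, - 3 * A0 p, 0],
     vector [0, 0, 0, 0, 0, - 1],
     vector [a61 p, a62 p, a63 p, a64 p, a65 p, - 1/3 * A1 p]]"

definition \<Omega>2 :: "real^2 \<Rightarrow> real^6^6" where
  "\<Omega>2 p = vector
    [vector [- 4/3 * A2 p, 2/3 * A1 p, 2 * A0 p, 1, 0, 0],
     vector [0, 0, 0, 0, - 1/2, 0],
     vector [0, - 2 * A3 p, 2/3 * A2 p, 0, 0, 0],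
     vector [0, 0, 0, 0, 0, - 1],
     vector [b51 p, b52 p, b53 p, 3 * A3 p, 1/3 * A2 p, 0],
     vector [b61 p, b62 p, b63 p, b64 p, b65 p, 1/3 * A2 p]]"

definition D1 :: "(real^2 \<Rightarrow> real^6) \<Rightarrow> real^2 \<Rightarrow> real^6" where
  "D1 W p = \<partial>\<^sub>x W p - W p v* \<Omega>1 p"

definition D2 :: "(real^2 \<Rightarrow> real^6) \<Rightarrow> real^2 \<Rightarrow> real^6" where
  "D2 W p = \<partial>\<^sub>y W p - W p v* \<Omega>2 p"

definition \<M> :: "real^2 \<Rightarrow> real^6^6" where
  "\<M> p = vector
    [\<V> p,
     D1 \<V> p,
     D2 \<V> p,
     D1 (D1 \<V>) p,
     (1/2) *\<^sub>R (D1 (D2 \<V>) p + D2 (D1 \<V>) p),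
     D2 (D2 \<V>) p]"

end

end

theory Submission
  imports Defs
begin

text \<open>A metric \<open>g\<close> in the projective class yields the functions \<open>\<psi> = \<bar>det g\<bar>\<close> to the power \<open>- 2/3\<close>
  times \<open>g\<^sub>1\<^sub>1, g\<^sub>1\<^sub>2, g\<^sub>2\<^sub>2\<close>, which solve Liouville's linear overdetermined first-order system. With
  \<open>\<mu> = 2 \<partial>\<^sub>x \<psi>\<^sub>2\<close>, \<open>\<nu> = 2 \<partial>\<^sub>y \<psi>\<^sub>2\<close> and \<open>\<rho> = \<partial>\<^sub>y \<mu> = \<partial>\<^sub>x \<nu>\<close> that system closes up to
  \<open>\<partial>\<^sub>a \<Psi> = - \<Omega>\<^sub>a \<Psi>\<close> for the column \<open>\<Psi> = (\<psi>\<^sub>1, \<psi>\<^sub>2, \<psi>\<^sub>3, \<mu>, \<nu>, \<rho>)\<close>. The curvature of this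
  connection has only its last row nonzero, namely \<open>- V\<close>, so that \<open>V \<cdot> \<Psi> = 0\<close>; differentiating
  twice shows that all rows of the matrix annihilate \<open>\<Psi> \<noteq> 0\<close>. As the metric is only \<open>C\<^sup>1\<close>,
  the differentiability of \<open>\<mu>\<close>, \<open>\<nu>\<close>, \<open>\<rho>\<close> has to be extracted from the system itself.\<close>

section \<open>Partial derivatives along the axes\<close>

text \<open>A derivative along a coordinate line makes sense without the Frechet differentiability
  that \<open>partial\<close> presupposes. Functions such as \<mu> and \<nu> are at first known to
  be differentiable in one direction only.\<close>

definition has_partial :: "2 \<Rightarrow> (real^2 \<Rightarrow> real) \<Rightarrow> real \<Rightarrow> real^2 \<Rightarrow> bool" where
  "has_partial a f d p \<longleftrightarrow> ((\<lambda>t. f (p + t *\<^sub>R axis a 1)) has_real_derivative d) (at 0)"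

named_theorems partial_intros

lemma has_partial_eq_rhs: "has_partial a f d p \<Longrightarrow> d = d' \<Longrightarrow> has_partial a f d' p"
  by simp

lemma has_partial_const [partial_intros]: "has_partial a (\<lambda>_. c) 0 p"
  by (simp add: has_partial_def)

lemma has_partial_add [partial_intros]:
  "has_partial a f d p \<Longrightarrow> has_partial a g e p \<Longrightarrow> has_partial a (\<lambda>q. f q + g q) (d + e) p"
  unfolding has_partial_def by (rule DERIV_add)

lemma has_partial_diff [partial_intros]:
  "has_partial a f d p \<Longrightarrow> has_partial a g e p \<Longrightarrow> has_partial a (\<lambda>q. f q - g q) (d - e) p"
  unfolding has_partial_def by (rule DERIV_diff)

lemma has_partial_minus [partial_intros]:
  "has_partial a f d p \<Longrightarrow> has_partial a (\<lambda>q. - f q) (- d) p"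
  unfolding has_partial_def by (rule DERIV_minus)

lemma has_partial_mult [partial_intros]:
  "has_partial a f d p \<Longrightarrow> has_partial a g e p \<Longrightarrow>
    has_partial a (\<lambda>q. f q * g q) (d * g p + f p * e) p"
  unfolding has_partial_def by (drule (1) DERIV_mult) (simp add: mult.commute)

lemma has_partial_square [partial_intros]:
  "has_partial a f d p \<Longrightarrow> has_partial a (\<lambda>q. (f q)\<^sup>2) (2 * f p * d) p"
  using has_partial_mult[of a f d p f d] by (simp add: power2_eq_square algebra_simps)

lemma has_partial_powr:
  assumes "has_partial a f d p" "f p > 0"
  shows "has_partial a (\<lambda>q. f q powr r) (r * f p powr (r - 1) * d) p"
  using has_real_derivative_powr[of "f p" r] assms unfolding has_partial_def
  by (auto intro!: derivative_eq_intros)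

lemma has_partial_unique: "has_partial a f d p \<Longrightarrow> has_partial a f e p \<Longrightarrow> d = e"
  unfolding has_partial_def by (rule DERIV_unique)

lemma eventually_axis_shift:
  assumes "open N" "(p :: real^2) \<in> N"
  shows "\<forall>\<^sub>F t in nhds (0::real). p + t *\<^sub>R axis a 1 \<in> N"
proof -
  have "((\<lambda>t. p + t *\<^sub>R axis a 1) \<longlongrightarrow> p) (nhds (0::real))"
    by (auto intro!: tendsto_eq_intros simp: tendsto_ident_at filterlim_ident)
  then show ?thesis using assms by (simp add: topological_tendstoD)
qed

lemma has_partial_cong:
  assumes "open N" "p \<in> N" "\<And>q. q \<in> N \<Longrightarrow> f q = g q" "has_partial a f d p"
  shows "has_partial a g d p"
  using assms(4) unfolding has_partial_def
  by (rule DERIV_cong_ev[THEN iffD1, rotated -1])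
     (use eventually_axis_shift[OF assms(1,2), of a] assms(3) in \<open>auto elim: eventually_mono\<close>)

lemma partial_eqI: "(f has_derivative f') (at p) \<Longrightarrow> partial a f p = f' (axis a 1)"
  unfolding partial_def by (metis frechet_derivative_at)

lemma has_partial_partial:
  assumes "f differentiable (at p)"
  shows "has_partial a f (partial a f p) p"
proof -
  have "(f has_derivative frechet_derivative f (at p)) (at (p + 0 *\<^sub>R axis a 1))"
    using frechet_derivative_works[THEN iffD1, OF assms] by simp
  then have "((\<lambda>t. f (p + t *\<^sub>R axis a 1)) has_derivative
      (\<lambda>t. frechet_derivative f (at p) (t *\<^sub>R axis a 1))) (at (0::real))"
    by (rule has_derivative_compose[rotated]) (auto intro!: derivative_eq_intros)
  moreover have "frechet_derivative f (at p) (t *\<^sub>R axis a 1) = partial a f p * t" for t :: real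
    using linear_frechet_derivative[OF assms] by (simp add: partial_def linear_scale)
  ultimately show ?thesis
    unfolding has_partial_def has_field_derivative_def by (simp add: fun_eq_iff[symmetric])
qed

lemma has_partial_imp_partial:
  "f differentiable (at p) \<Longrightarrow> has_partial a f d p \<Longrightarrow> partial a f p = d"
  by (rule has_partial_unique[OF has_partial_partial])

text \<open>\<open>frechet_derivative\<close> is a choice among all derivatives, and functions that
  agree near \<open>p\<close> have the same ones; so locality holds even where no derivative
  exists.\<close>

lemma partial_cong:
  assumes "open N" "p \<in> N" "\<And>q. q \<in> N \<Longrightarrow> f q = g q"
  shows "partial a f p = partial a g p"
proof -
  have *: "\<forall>\<^sub>F x in nhds p. f x = g x"
    using assms eventually_nhds by blast
  have "(f has_derivative D) (at p) = (g has_derivative D) (at p)" for D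
    using assms has_derivative_transform_within_open[of f D p UNIV N g]
      has_derivative_transform_within_open[of g D p UNIV N f] by auto
  then show ?thesis unfolding partial_def frechet_derivative_def by simp
qed

lemma differentiable_cong_open:
  fixes f :: "real^2 \<Rightarrow> 'b::real_normed_vector"
  assumes "open N" "p \<in> N" "\<And>q. q \<in> N \<Longrightarrow> f q = g q" "f differentiable (at p)"
  shows "g differentiable (at p)"
  using assms has_derivative_transform_within_open[of f _ p UNIV N g] unfolding differentiable_def by blast

section \<open>Mean value estimates, the C^1 criterion and mixed derivatives\<close>

lemma has_partial_line:
  assumes "has_partial a f d (p + s *\<^sub>R axis a 1)"
  shows "((\<lambda>t. f (p + t *\<^sub>R axis a 1)) has_real_derivative d) (at s)"
  using DERIV_at_within_shift[of "\<lambda>t. f (p + t *\<^sub>R axis a 1)" d s 0 UNIV] assms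
  by (simp add: has_partial_def scaleR_left_distrib add_ac)

lemma norm_unit_axis [simp]: "norm (axis a 1 :: real^2) = 1"
  by (simp add: norm_axis_1)

text \<open>Mean value inequality for \<open>f\<close> along the line minus a linear function of
  slope \<open>c\<close>; \<open>closed_segment\<close> admits both signs of
  \<open>h\<close>.\<close>

lemma line_bound:
  assumes "\<And>t. t \<in> closed_segment 0 h \<Longrightarrow> has_partial a f (f' (p + t *\<^sub>R axis a 1)) (p + t *\<^sub>R axis a 1)"
    and "\<And>t. t \<in> closed_segment 0 h \<Longrightarrow> \<bar>f' (p + t *\<^sub>R axis a 1) - c\<bar> \<le> e"
  shows "\<bar>f (p + h *\<^sub>R axis a 1) - f p - c * h\<bar> \<le> e * \<bar>h\<bar>"
proof -
  let ?g = "\<lambda>t. f (p + t *\<^sub>R axis a 1) - c * t"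
  have "norm (?g h - ?g 0) \<le> e * norm (h - 0)"
  proof (rule field_differentiable_bound[of "closed_segment 0 h"])
    fix t assume t: "t \<in> closed_segment 0 h"
    have "(?g has_real_derivative f' (p + t *\<^sub>R axis a 1) - c) (at t)"
      using has_partial_line[OF assms(1)[OF t]] by (auto intro!: derivative_eq_intros)
    then show "(?g has_real_derivative f' (p + t *\<^sub>R axis a 1) - c) (at t within closed_segment 0 h)"
      by (rule DERIV_subset) simp
    show "norm (f' (p + t *\<^sub>R axis a 1) - c) \<le> e" using assms(2)[OF t] by simp
  qed auto
  then show ?thesis by simp
qed

lemma in_segment_0: "t \<in> closed_segment 0 (h::real) \<Longrightarrow> \<bar>t\<bar> \<le> \<bar>h\<bar>"
  by (auto simp: closed_segment_eq_real_ivl split: if_splits)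

lemma continuous_on_eventually_close:
  fixes w :: "real^2 \<Rightarrow> real"
  assumes "open N" "p \<in> N" "continuous_on N w" "e > (0::real)"
  shows "\<forall>\<^sub>F q in nhds p. q \<in> N \<and> \<bar>w q - w p\<bar> < e"
proof -
  have "(w \<longlongrightarrow> w p) (nhds p)"
    using assms by (simp add: continuous_on_eq_continuous_at isCont_def tendsto_at_iff_tendsto_nhds)
  then have "\<forall>\<^sub>F q in nhds p. \<bar>w q - w p\<bar> < e"
    using assms(4) by (auto dest: tendstoD simp: dist_real_def)
  then show ?thesis using assms by (simp add: eventually_conj_iff eventually_nhds_in_open)
qed

text \<open>The point \<open>y\<close> is reached from \<open>p\<close> along the first axis and
  then along the second; by \<open>line_bound\<close> each leg contributes an error of at most
  \<open>e/2\<close> times its length.\<close>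

lemma has_derivative_from_partials:
  assumes N: "open N" "p \<in> N"
    and f1: "\<And>q. q \<in> N \<Longrightarrow> has_partial 1 f (f1 q) q" and f2: "\<And>q. q \<in> N \<Longrightarrow> has_partial 2 f (f2 q) q"
    and c1: "continuous_on N f1" and c2: "continuous_on N f2"
  shows "(f has_derivative (\<lambda>h. f1 p * h$1 + f2 p * h$2)) (at p)"
  unfolding has_derivative_at_alt
proof (intro conjI allI impI)
  show "bounded_linear (\<lambda>h. f1 p * h$1 + f2 p * h$2)"
    by (intro bounded_linear_intros bounded_linear_vec_nth bounded_linear_compose[OF bounded_linear_mult_right])
  fix e :: real assume "e > 0"
  then have "\<forall>\<^sub>F q in nhds p. q \<in> N \<and> \<bar>f1 q - f1 p\<bar> < e/2 \<and> \<bar>f2 q - f2 p\<bar> < e/2"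
    using continuous_on_eventually_close[OF N c1, of "e/2"] continuous_on_eventually_close[OF N c2, of "e/2"]
    by (auto elim: eventually_elim2)
  then obtain d where d: "d > 0"
    and D: "\<And>q. dist q p < d \<Longrightarrow> q \<in> N \<and> \<bar>f1 q - f1 p\<bar> < e/2 \<and> \<bar>f2 q - f2 p\<bar> < e/2"
    unfolding eventually_nhds_metric by blast
  show "\<exists>d>0. \<forall>y. norm (y - p) < d \<longrightarrow>
      norm (f y - f p - (f1 p * (y - p)$1 + f2 p * (y - p)$2)) \<le> e * norm (y - p)"
  \<comment> \<open>Both legs are shorter than \<open>d/2\<close>, so the path stays within distance
    \<open>d\<close> of \<open>p\<close>.\<close>
  proof (intro exI[of _ "d/2"] conjI allI impI)
    fix y :: "real^2" assume y: "norm (y - p) < d/2"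
    define h k where "h = (y - p)$1" and "k = (y - p)$2"
    have hk: "\<bar>h\<bar> \<le> norm (y - p)" "\<bar>k\<bar> \<le> norm (y - p)"
      unfolding h_def k_def by (rule component_le_norm_cart)+
    let ?q = "p + h *\<^sub>R axis 1 1"
    have yq: "y = ?q + k *\<^sub>R axis 2 1"
      by (simp add: vec_eq_iff forall_2 h_def k_def axis_def)
    have 1: "\<bar>f ?q - f p - f1 p * h\<bar> \<le> e/2 * \<bar>h\<bar>"
    proof (rule line_bound)
      fix t assume "t \<in> closed_segment 0 h"
      then have "dist (p + t *\<^sub>R axis 1 1) p < d"
        using in_segment_0[of t h] hk y by (simp add: dist_norm)
      from D[OF this] f1 show "has_partial 1 f (f1 (p + t *\<^sub>R axis 1 1)) (p + t *\<^sub>R axis 1 1)"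
        "\<bar>f1 (p + t *\<^sub>R axis 1 1) - f1 p\<bar> \<le> e/2" by auto
    qed
    have 2: "\<bar>f (?q + k *\<^sub>R axis 2 1) - f ?q - f2 p * k\<bar> \<le> e/2 * \<bar>k\<bar>"
    proof (rule line_bound)
      fix t assume "t \<in> closed_segment 0 k"
      then have "norm (h *\<^sub>R axis 1 1 + t *\<^sub>R (axis 2 1 :: real^2)) < d"
        using in_segment_0[of t k] hk y norm_triangle_ineq[of "h *\<^sub>R axis 1 1" "t *\<^sub>R (axis 2 1 :: real^2)"]
        by simp
      then have "dist (?q + t *\<^sub>R axis 2 1) p < d" by (simp add: dist_norm add.assoc)
      from D[OF this] f2 show "has_partial 2 f (f2 (?q + t *\<^sub>R axis 2 1)) (?q + t *\<^sub>R axis 2 1)"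
        "\<bar>f2 (?q + t *\<^sub>R axis 2 1) - f2 p\<bar> \<le> e/2" by auto
    qed
    have "f y = f (?q + k *\<^sub>R axis 2 1)" using yq by (rule arg_cong)
    then have "\<bar>f y - f p - (f1 p * h + f2 p * k)\<bar> \<le> e/2 * \<bar>h\<bar> + e/2 * \<bar>k\<bar>"
      using 1 2 by linarith
    also have "\<dots> \<le> e/2 * norm (y - p) + e/2 * norm (y - p)"
      using hk \<open>e > 0\<close> by (intro add_mono mult_left_mono) auto
    finally show "norm (f y - f p - (f1 p * (y - p)$1 + f2 p * (y - p)$2)) \<le> e * norm (y - p)"
      by (simp add: h_def k_def)
  qed (use d in simp)
qed

lemma partials_imp_differentiable:
  assumes "open N" "p \<in> N" "\<And>q. q \<in> N \<Longrightarrow> has_partial 1 f (f1 q) q"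
    "\<And>q. q \<in> N \<Longrightarrow> has_partial 2 f (f2 q) q" "continuous_on N f1" "continuous_on N f2"
  shows "f differentiable (at p)"
  using has_derivative_from_partials[OF assms] differentiableI by blast

text \<open>The cross derivative is not assumed to be a Frechet derivative of \<open>f\<close>, and \<open>v\<close> is
  not assumed to be differentiable in direction \<open>a\<close>: this is what gains regularity below.\<close>
lemma has_partial_swap:
  assumes N: "open N" "p \<in> N"
    and u: "\<And>q. q \<in> N \<Longrightarrow> has_partial a f (u q) q" and v: "\<And>q. q \<in> N \<Longrightarrow> has_partial b f (v q) q"
    and w: "\<And>q. q \<in> N \<Longrightarrow> has_partial b u (w q) q" and cw: "continuous_on N w"
  shows "has_partial a v (w p) p"
  unfolding has_partial_def has_field_derivative_def has_derivative_at_alt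
proof (intro conjI allI impI)
  show "bounded_linear ((*) (w p))" by (rule bounded_linear_mult_right)
  fix e :: real assume "e > 0"
  then have "\<forall>\<^sub>F q in nhds p. q \<in> N \<and> \<bar>w q - w p\<bar> < e"
    using continuous_on_eventually_close[OF N cw] by blast
  then obtain d where d: "d > 0"
    and D: "\<And>q. dist q p < d \<Longrightarrow> q \<in> N \<and> \<bar>w q - w p\<bar> < e"
    unfolding eventually_nhds_metric by blast
  have D': "p + s *\<^sub>R axis a 1 + t *\<^sub>R axis b 1 \<in> N \<and> \<bar>w (p + s *\<^sub>R axis a 1 + t *\<^sub>R axis b 1) - w p\<bar> < e"
    if "\<bar>s\<bar> < d/2" "\<bar>t\<bar> < d/2" for s t
  proof (rule D)
    have "norm (s *\<^sub>R axis a 1 + t *\<^sub>R (axis b 1 :: real^2)) < d"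
      using that norm_triangle_ineq[of "s *\<^sub>R axis a 1" "t *\<^sub>R (axis b 1 :: real^2)"] by simp
    then show "dist (p + s *\<^sub>R axis a 1 + t *\<^sub>R axis b 1) p < d" by (simp add: dist_norm add.assoc)
  qed
  show "\<exists>d>0. \<forall>y. norm (y - 0) < d \<longrightarrow>
      norm (v (p + y *\<^sub>R axis a 1) - v (p + 0 *\<^sub>R axis a 1) - w p * (y - 0)) \<le> e * norm (y - 0)"
  proof (intro exI[of _ "d/2"] conjI allI impI)
    fix s :: real assume "norm (s - 0) < d/2"
    then have s: "\<bar>s\<bar> < d/2" by simp
    \<comment> \<open>The second difference of \<open>f\<close> is estimated by nested uses of
      \<open>line_bound\<close>: in direction \<open>a\<close> for the increment \<open>?h\<close>,
      whose derivative is an increment of \<open>u\<close>, and in direction \<open>b\<close> for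
      \<open>u\<close> itself.\<close>
    have *: "\<bar>f (p + s *\<^sub>R axis a 1 + t *\<^sub>R axis b 1) - f (p + t *\<^sub>R axis b 1)
         - (f (p + s *\<^sub>R axis a 1) - f p) - w p * t * s\<bar> \<le> (e * \<bar>t\<bar>) * \<bar>s\<bar>" if t: "\<bar>t\<bar> < d/2" for t
    proof -
      let ?h = "\<lambda>q. f (q + t *\<^sub>R axis b 1) - f q"
      have "\<bar>?h (p + s *\<^sub>R axis a 1) - ?h p - (w p * t) * s\<bar> \<le> (e * \<bar>t\<bar>) * \<bar>s\<bar>"
      proof (rule line_bound[where f' = "\<lambda>q. u (q + t *\<^sub>R axis b 1) - u q"])
        fix r assume "r \<in> closed_segment 0 s"
        then have r: "\<bar>r\<bar> < d/2" using in_segment_0[of r s] s by simp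
        let ?q = "p + r *\<^sub>R axis a 1"
        have q: "?q + x *\<^sub>R axis b 1 \<in> N" if "\<bar>x\<bar> < d/2" for x using D'[OF r that] by simp
        have "?q \<in> N" using q[of 0] d by simp
        show "has_partial a ?h (u (?q + t *\<^sub>R axis b 1) - u ?q) ?q"
          using has_partial_diff[OF _ u[OF \<open>?q \<in> N\<close>], of "\<lambda>q. f (q + t *\<^sub>R axis b 1)"] u[OF q[OF t]]
          by (simp add: has_partial_def add_ac)
        show "\<bar>u (?q + t *\<^sub>R axis b 1) - u ?q - w p * t\<bar> \<le> e * \<bar>t\<bar>"
        proof (rule line_bound[where f' = w])
          fix x assume "x \<in> closed_segment 0 t"
          then have x: "\<bar>x\<bar> < d/2" using in_segment_0[of x t] t by simp
          show "has_partial b u (w (?q + x *\<^sub>R axis b 1)) (?q + x *\<^sub>R axis b 1)"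
            by (rule w[OF q[OF x]])
          show "\<bar>w (?q + x *\<^sub>R axis b 1) - w p\<bar> \<le> e" using D'[OF r x] by simp
        qed
      qed
      then show ?thesis by (simp add: add_ac)
    qed
    \<comment> \<open>Dividing the second difference by \<open>t\<close> and letting
      \<open>t\<close> tend to 0 turns it into an increment of \<open>v\<close>, and the bound
      survives the limit.\<close>
    let ?k = "\<lambda>t. f (p + s *\<^sub>R axis a 1 + t *\<^sub>R axis b 1) - f (p + t *\<^sub>R axis b 1) - w p * s * t"
    have "p \<in> N" "p + s *\<^sub>R axis a 1 \<in> N" using N D'[of s 0] s d by auto
    then have "(?k has_real_derivative v (p + s *\<^sub>R axis a 1) - v p - w p * s) (at 0)"
      using v unfolding has_partial_def by (auto intro!: derivative_eq_intros)
    then have "((\<lambda>t. (?k t - ?k 0) / t) \<longlongrightarrow> v (p + s *\<^sub>R axis a 1) - v p - w p * s) (at 0)"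
      by (simp add: has_field_derivative_iff)
    then have lim: "((\<lambda>t. \<bar>(?k t - ?k 0) / t\<bar>) \<longlongrightarrow> \<bar>v (p + s *\<^sub>R axis a 1) - v p - w p * s\<bar>) (at 0)"
      by (rule tendsto_rabs)
    have ev: "\<forall>\<^sub>F t in at 0. \<bar>(?k t - ?k 0) / t\<bar> \<le> e * \<bar>s\<bar>"
    proof -
      have "\<forall>\<^sub>F t in at (0::real). \<bar>t\<bar> < d/2 \<and> t \<noteq> 0"
        unfolding eventually_at by (intro exI[of _ "d/2"]) (use d in \<open>auto simp: dist_real_def\<close>)
      then show ?thesis
      proof (rule eventually_mono)
        fix t :: real assume t: "\<bar>t\<bar> < d/2 \<and> t \<noteq> 0"
        have "\<bar>?k t - ?k 0\<bar> \<le> (e * \<bar>t\<bar>) * \<bar>s\<bar>" using *[of t] t by (simp add: algebra_simps)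
        then show "\<bar>(?k t - ?k 0) / t\<bar> \<le> e * \<bar>s\<bar>"
          using t by (simp add: divide_simps mult_ac)
      qed
    qed
    have "\<bar>v (p + s *\<^sub>R axis a 1) - v p - w p * s\<bar> \<le> e * \<bar>s\<bar>"
      by (rule tendsto_upperbound[OF lim ev]) simp
    then show "norm (v (p + s *\<^sub>R axis a 1) - v (p + 0 *\<^sub>R axis a 1) - w p * (s - 0)) \<le> e * norm (s - 0)"
      by simp
  qed (use d in simp)
qed

section \<open>Regularity from an ordinary differential equation with parameter\<close>

text \<open>The integral of \<open>w\<close> in its first variable from 0 to \<open>s\<close>,
  substituted to the fixed domain [0, 1]. This covers negative \<open>s\<close> and leaves constant
  limits for differentiation in \<open>t\<close>.\<close>

definition ray_integral :: "(real \<Rightarrow> real \<Rightarrow> real) \<Rightarrow> real \<Rightarrow> real \<Rightarrow> real" where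
  "ray_integral w s t = integral {0..1} (\<lambda>r. s * w (r * s) t)"

lemma scaled_in_symmetric_interval:
  fixes r s \<delta> :: real
  assumes "r \<in> {0..1}" "s \<in> {-\<delta>..\<delta>}"
  shows "r * s \<in> {-\<delta>..\<delta>}"
proof -
  have "\<bar>r * s\<bar> \<le> 1 * \<bar>s\<bar>" unfolding abs_mult using assms by (intro mult_right_mono) auto
  then show ?thesis using assms by auto
qed

lemma ray_integrand_continuous:
  fixes w :: "real \<Rightarrow> real \<Rightarrow> real"
  assumes "continuous_on ({-\<delta>..\<delta>} \<times> {-\<delta>..\<delta>}) (\<lambda>(s, t). w s t)"
  shows "continuous_on (({-\<delta>..\<delta>} \<times> {-\<delta>..\<delta>}) \<times> {0..1::real}) (\<lambda>(p, r). fst p * w (r * fst p) (snd p))"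
  using scaled_in_symmetric_interval
  by (auto simp: split_beta intro!: continuous_intros continuous_on_compose2[OF assms, unfolded split_beta,
      where f = "\<lambda>z. (snd z * fst (fst z), snd (fst z))", simplified])

lemma ray_integral_continuous:
  fixes w :: "real \<Rightarrow> real \<Rightarrow> real"
  assumes "continuous_on ({-\<delta>..\<delta>} \<times> {-\<delta>..\<delta>}) (\<lambda>(s, t). w s t)"
  shows "continuous_on ({-\<delta>..\<delta>} \<times> {-\<delta>..\<delta>}) (\<lambda>(s, t). ray_integral w s t)"
  using integral_continuous_on_param[of _ "0::real" 1, simplified, OF ray_integrand_continuous[OF assms]]
  by (simp add: ray_integral_def split_beta)

lemma ray_integrand_continuous_1:
  fixes w :: "real \<Rightarrow> real \<Rightarrow> real"
  assumes "continuous_on ({-\<delta>..\<delta>} \<times> {-\<delta>..\<delta>}) (\<lambda>(s, t). w s t)" "s \<in> {-\<delta>..\<delta>}"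
  shows "continuous_on ({-\<delta>..\<delta>} \<times> {0..1::real}) (\<lambda>(t, r). s * w (r * s) t)"
  unfolding split_beta
  using assms(2) by (intro continuous_on_compose2[OF ray_integrand_continuous[OF assms(1)], unfolded split_beta,
      where f = "\<lambda>z. ((s, fst z), snd z)", simplified] continuous_intros) auto

lemma ray_integrand_integrable:
  fixes w :: "real \<Rightarrow> real \<Rightarrow> real"
  assumes "continuous_on ({-\<delta>..\<delta>} \<times> {-\<delta>..\<delta>}) (\<lambda>(s, t). w s t)" "s \<in> {-\<delta>..\<delta>}" "t \<in> {-\<delta>..\<delta>}"
  shows "(\<lambda>r. s * w (r * s) t) integrable_on {0..1}"
  using assms(3) by (intro integrable_continuous_real
     continuous_on_compose2[OF ray_integrand_continuous_1[OF assms(1,2)], unfolded split_beta,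
      where f = "\<lambda>r. (t, r)", simplified] continuous_intros) auto

lemma ray_integral_has_derivative:
  fixes w :: "real \<Rightarrow> real \<Rightarrow> real"
  assumes w: "continuous_on ({-\<delta>..\<delta>} \<times> {-\<delta>..\<delta>}) (\<lambda>(s, t). w s t)"
    and w': "continuous_on ({-\<delta>..\<delta>} \<times> {-\<delta>..\<delta>}) (\<lambda>(s, t). w' s t)"
    and D: "\<And>s t. s \<in> {-\<delta>..\<delta>} \<Longrightarrow> t \<in> {-\<delta>..\<delta>} \<Longrightarrow>
      (w s has_real_derivative w' s t) (at t within {-\<delta>..\<delta>})"
    and st: "s \<in> {-\<delta>..\<delta>}" "t \<in> {-\<delta>..\<delta>}"
  shows "(ray_integral w s has_real_derivative ray_integral w' s t) (at t within {-\<delta>..\<delta>})"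
proof -
  have "((\<lambda>t. integral (cbox 0 1) (\<lambda>r. s * w (r * s) t)) has_real_derivative
      integral (cbox 0 1) (\<lambda>r. s * w' (r * s) t)) (at t within {-\<delta>..\<delta>})"
  proof (rule leibniz_rule_field_derivative[where U = "{-\<delta>..\<delta>}" and fx = "\<lambda>t r. s * w' (r * s) t"])
    fix t r :: real assume "t \<in> {-\<delta>..\<delta>}" "r \<in> cbox 0 1"
    then show "((\<lambda>t. s * w (r * s) t) has_real_derivative s * w' (r * s) t) (at t within {-\<delta>..\<delta>})"
      using scaled_in_symmetric_interval[OF _ st(1)] by (auto intro!: DERIV_cmult D)
  qed (use ray_integrand_integrable[OF w st(1)] ray_integrand_continuous_1[OF w' st(1)] st in auto)
  then show ?thesis by (simp add: ray_integral_def[abs_def])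
qed

text \<open>Fundamental theorem of calculus along \<open>r * s\<close> for \<open>r\<close> in
  [0, 1]; the chain rule supplies the factor \<open>s\<close> of the integrand.\<close>

lemma ray_integral_of_derivative:
  assumes D: "\<And>s. s \<in> {-\<delta>..\<delta>} \<Longrightarrow> ((\<lambda>s. g s t) has_real_derivative h s t) (at s within {-\<delta>..\<delta>})"
    and s: "s \<in> {-\<delta>..\<delta>}"
  shows "g s t - g 0 t = ray_integral h s t"
proof -
  have "((\<lambda>r. s * h (r * s) t) has_integral g (1 * s) t - g (0 * s) t) {0..1}"
  proof (rule fundamental_theorem_of_calculus)
    fix r :: real assume r: "r \<in> {0..1}"
    have "((\<lambda>s. g s t) has_vector_derivative h (r * s) t) (at (r * s) within (\<lambda>r. r * s) ` {0..1})"
      using D[OF scaled_in_symmetric_interval[OF r s]] scaled_in_symmetric_interval[OF _ s]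
      by (auto simp: has_real_derivative_iff_has_vector_derivative intro: has_vector_derivative_within_subset)
    moreover have "((\<lambda>r. r * s) has_vector_derivative s) (at r within {0..1})"
      by (auto simp: has_real_derivative_iff_has_vector_derivative[symmetric] intro!: derivative_eq_intros)
    ultimately show "((\<lambda>r. g (r * s) t) has_vector_derivative s * h (r * s) t) (at r within {0..1})"
      using vector_diff_chain_within[of "\<lambda>r. r * s" s r "{0..1}" "\<lambda>s. g s t" "h (r * s) t"] by (simp add: o_def)
  qed simp
  then show ?thesis unfolding ray_integral_def by (subst integral_unique) simp_all
qed

text \<open>Integrating \<open>\<partial>\<^sub>s f = \<alpha> + m\<close> over \<open>0 \<le> s \<le> \<delta>\<close>, where \<open>m\<close> differs from \<open>m 0\<close> by an integral
  of \<open>k\<close>, expresses \<open>m 0\<close> through functions that are differentiable in \<open>t\<close>.\<close>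
lemma derivative_gain_on_square:
  fixes f :: "real \<Rightarrow> real \<Rightarrow> real"
  assumes "\<delta> > 0"
  defines "B \<equiv> {-\<delta>..\<delta>}"
  assumes fs: "\<And>s t. s \<in> B \<Longrightarrow> t \<in> B \<Longrightarrow> ((\<lambda>s. f s t) has_real_derivative \<alpha> s t + m s t) (at s within B)"
    and ft: "\<And>s t. s \<in> B \<Longrightarrow> t \<in> B \<Longrightarrow> (f s has_real_derivative v s t) (at t within B)"
    and \<alpha>t: "\<And>s t. s \<in> B \<Longrightarrow> t \<in> B \<Longrightarrow> (\<alpha> s has_real_derivative \<alpha>' s t) (at t within B)"
    and ms: "\<And>s t. s \<in> B \<Longrightarrow> t \<in> B \<Longrightarrow> ((\<lambda>s. m s t) has_real_derivative k s t) (at s within B)"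
    and kt: "\<And>s t. s \<in> B \<Longrightarrow> t \<in> B \<Longrightarrow> (k s has_real_derivative l s t) (at t within B)"
    and cont: "continuous_on (B \<times> B) (\<lambda>(s, t). v s t)" "continuous_on (B \<times> B) (\<lambda>(s, t). \<alpha> s t)"
      "continuous_on (B \<times> B) (\<lambda>(s, t). \<alpha>' s t)"
      "continuous_on (B \<times> B) (\<lambda>(s, t). k s t)" "continuous_on (B \<times> B) (\<lambda>(s, t). l s t)"
  shows "\<exists>n. continuous_on (B \<times> B) (\<lambda>(s, t). n s t) \<and>
    (\<forall>s\<in>B. \<forall>t\<in>B. (m s has_real_derivative n s t) (at t within B))"
proof -
  let ?K = "ray_integral k" and ?L = "ray_integral l"
  let ?w = "\<lambda>s t. \<alpha> s t + ?K s t" and ?w' = "\<lambda>s t. \<alpha>' s t + ?L s t"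
  have B: "\<delta> \<in> B" "0 \<in> B" using \<open>\<delta> > 0\<close> by (auto simp: B_def)
  have cK: "continuous_on (B \<times> B) (\<lambda>(s, t). ?K s t)" and cL: "continuous_on (B \<times> B) (\<lambda>(s, t). ?L s t)"
    using cont unfolding B_def by (auto intro: ray_integral_continuous)
  have Kt: "(?K s has_real_derivative ?L s t) (at t within B)" if "s \<in> B" "t \<in> B" for s t
    using that cont kt unfolding B_def by (intro ray_integral_has_derivative)
  have cw: "continuous_on (B \<times> B) (\<lambda>(s, t). ?w s t)" "continuous_on (B \<times> B) (\<lambda>(s, t). ?w' s t)"
    using cont cK cL by (auto simp: split_beta intro: continuous_intros)
  have wt: "(ray_integral ?w s has_real_derivative ray_integral ?w' s t) (at t within B)" if "s \<in> B" "t \<in> B" for s t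
    using that cw DERIV_add[OF \<alpha>t Kt] unfolding B_def by (intro ray_integral_has_derivative)
  have m: "m s t = m 0 t + ?K s t" if "s \<in> B" "t \<in> B" for s t
    using ray_integral_of_derivative[of \<delta> m t k s] ms that unfolding B_def by simp
  \<comment> \<open>\<open>m 0 t\<close> is constant in the integration variable, so it contributes
    \<open>\<delta> * m 0 t\<close>, and the equation can be solved for it.\<close>
  have m0: "m 0 t = (f \<delta> t - f 0 t - ray_integral ?w \<delta> t) / \<delta>" if t: "t \<in> B" for t
  proof -
    have rB: "r * \<delta> \<in> B" if "r \<in> {0..1}" for r using scaled_in_symmetric_interval[OF that, of \<delta> \<delta>] B
      by (simp add: B_def)
    have "f \<delta> t - f 0 t = ray_integral (\<lambda>s t. \<alpha> s t + m s t) \<delta> t"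
      using ray_integral_of_derivative[of \<delta> f t _ \<delta>] fs t B unfolding B_def by simp
    also have "\<dots> = integral {0..1} (\<lambda>r. \<delta> * ?w (r * \<delta>) t + \<delta> * m 0 t)"
      unfolding ray_integral_def[of "\<lambda>s t. \<alpha> s t + m s t"]
    proof (rule integral_cong)
      fix r :: real assume "r \<in> {0..1}"
      then show "\<delta> * (\<alpha> (r * \<delta>) t + m (r * \<delta>) t) = \<delta> * ?w (r * \<delta>) t + \<delta> * m 0 t"
        by (subst m[OF rB t]) (auto simp: algebra_simps)
    qed
    also have "\<dots> = ray_integral ?w \<delta> t + \<delta> * m 0 t"
      unfolding ray_integral_def[of ?w]
      using ray_integrand_integrable[OF cw(1)[unfolded B_def] B(1)[unfolded B_def] t[unfolded B_def]]
      by (subst integral_add) auto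
    finally show ?thesis using \<open>\<delta> > 0\<close> by (simp add: field_simps)
  qed
  \<comment> \<open>The \<open>t\<close>-derivative of the formula \<open>m0\<close>, with
    \<open>v\<close> for that of \<open>f\<close> and \<open>?w'\<close> for that of
    \<open>?w\<close>.\<close>
  define n0 where "n0 = (\<lambda>t. (v \<delta> t - v 0 t - ray_integral ?w' \<delta> t) / \<delta>)"
  have m0t: "(m 0 has_real_derivative n0 t) (at t within B)" if t: "t \<in> B" for t
  proof -
    have "((\<lambda>t. (f \<delta> t - f 0 t - ray_integral ?w \<delta> t) / \<delta>) has_real_derivative n0 t) (at t within B)"
      unfolding n0_def using ft wt B t by (intro DERIV_cdivide DERIV_diff) auto
    then show ?thesis
      by (rule has_field_derivative_transform_within[of _ _ _ _ 1]) (use m0 t in auto)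
  qed
  have restrict: "continuous_on (B \<times> B) (\<lambda>z. g s (snd z))"
    if "continuous_on (B \<times> B) (\<lambda>(s, t). g s t)" "s \<in> B" for g :: "real \<Rightarrow> real \<Rightarrow> real" and s
    using that(2) by (auto intro!: continuous_on_compose2[OF that(1), unfolded split_beta,
          where f = "\<lambda>z. (s, snd z)", simplified] continuous_intros)
  have cn0: "continuous_on (B \<times> B) (\<lambda>z. n0 (snd z))"
    unfolding n0_def
    using cont(1) ray_integral_continuous[OF cw(2)[unfolded B_def]] B \<open>\<delta> > 0\<close>
    by (intro continuous_intros restrict) (auto simp: B_def)
  show ?thesis
  proof (intro exI[of _ "\<lambda>s t. n0 t + ?L s t"] conjI ballI)
    show "continuous_on (B \<times> B) (\<lambda>(s, t). n0 t + ?L s t)"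
      using cn0 cL by (auto simp: split_beta intro: continuous_intros)
    fix s t assume st: "s \<in> B" "t \<in> B"
    show "(m s has_real_derivative n0 t + ?L s t) (at t within B)"
      by (rule has_field_derivative_transform_within[OF DERIV_add[OF m0t Kt], of _ _ 1]) (use m st in auto)
  qed
qed

text \<open>\<open>derivative_gain_on_square\<close> applies on a small coordinate square about each
  point. Directional derivatives are unique, so the local results fit together into one continuous
  function.\<close>

lemma has_partial_gain:
  assumes N: "open N"
    and f1: "\<And>q. q \<in> N \<Longrightarrow> has_partial 1 f (\<alpha> q + m q) q"
    and f2: "\<And>q. q \<in> N \<Longrightarrow> has_partial 2 f (v q) q"
    and \<alpha>2: "\<And>q. q \<in> N \<Longrightarrow> has_partial 2 \<alpha> (\<alpha>' q) q"
    and m1: "\<And>q. q \<in> N \<Longrightarrow> has_partial 1 m (k q) q"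
    and k2: "\<And>q. q \<in> N \<Longrightarrow> has_partial 2 k (l q) q"
    and cont: "continuous_on N v" "continuous_on N \<alpha>" "continuous_on N \<alpha>'"
      "continuous_on N k" "continuous_on N l"
  obtains n where "continuous_on N n" "\<And>q. q \<in> N \<Longrightarrow> has_partial 2 m (n q) q"
proof -
  have local: "\<exists>n M. open M \<and> p \<in> M \<and> M \<subseteq> N \<and> continuous_on M n \<and> (\<forall>q\<in>M. has_partial 2 m (n q) q)"
    if p: "p \<in> N" for p
  proof -
    obtain d where d: "d > 0" "ball p d \<subseteq> N" using N p openE by blast
    \<comment> \<open>On the square, |s| + |t| is at most 2d/3, so the square lies in the ball of
      radius \<open>d\<close>.\<close>
    define \<delta> where "\<delta> = d / 3"
    define B where "B = {-\<delta>..\<delta>}"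
    define Q where "Q = (\<lambda>s t. p + s *\<^sub>R axis 1 1 + t *\<^sub>R axis 2 (1::real))"
    have \<delta>: "\<delta> > 0" using d by (simp add: \<delta>_def)
    have QN: "Q s t \<in> N" if "s \<in> B" "t \<in> B" for s t
    proof -
      have "norm (s *\<^sub>R axis 1 1 + t *\<^sub>R (axis 2 1 :: real^2)) < d"
        using that d norm_triangle_ineq[of "s *\<^sub>R axis 1 1" "t *\<^sub>R (axis 2 1 :: real^2)"] by (auto simp: B_def \<delta>_def)
      then have "dist (Q s t) p < d" by (simp add: Q_def dist_norm add.assoc)
      then show ?thesis using d by (auto simp: subset_eq dist_commute)
    qed
    have Qc: "continuous_on (B \<times> B) (\<lambda>(s, t). w (Q s t))" if "continuous_on N w" for w :: "real^2 \<Rightarrow> real"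
      unfolding split_beta Q_def using QN[unfolded Q_def]
      by (intro continuous_on_compose2[OF that] continuous_intros) auto
    have D1: "((\<lambda>s. w (Q s t)) has_real_derivative w' (Q s t)) (at s within X)"
      if "\<And>q. q \<in> N \<Longrightarrow> has_partial 1 w (w' q) q" "s \<in> B" "t \<in> B" for w w' s t X
    proof -
      have "((\<lambda>s. w (Q s t)) has_real_derivative w' (Q s t)) (at s)"
        using has_partial_line[of 1 w "w' (Q s t)" "p + t *\<^sub>R axis 2 1" s] that(1)[OF QN[OF that(2,3)]]
        by (simp add: Q_def add_ac)
      then show ?thesis by (rule has_field_derivative_at_within)
    qed
    have D2: "((\<lambda>t. w (Q s t)) has_real_derivative w' (Q s t)) (at t within X)"
      if "\<And>q. q \<in> N \<Longrightarrow> has_partial 2 w (w' q) q" "s \<in> B" "t \<in> B" for w w' s t X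
    proof -
      have "((\<lambda>t. w (Q s t)) has_real_derivative w' (Q s t)) (at t)"
        using has_partial_line[of 2 w "w' (Q s t)" "p + s *\<^sub>R axis 1 1" t] that(1)[OF QN[OF that(2,3)]]
        by (simp add: Q_def add_ac)
      then show ?thesis by (rule has_field_derivative_at_within)
    qed
    have "\<exists>n. continuous_on (B \<times> B) (\<lambda>(s, t). n s t) \<and>
      (\<forall>s\<in>B. \<forall>t\<in>B. ((\<lambda>t. m (Q s t)) has_real_derivative n s t) (at t within B))"
    proof (rule derivative_gain_on_square[OF \<delta>, folded B_def])
      show "((\<lambda>s. f (Q s t)) has_real_derivative \<alpha> (Q s t) + m (Q s t)) (at s within B)"
        if "s \<in> B" "t \<in> B" for s t using f1 that by (rule D1)
      show "((\<lambda>t. f (Q s t)) has_real_derivative v (Q s t)) (at t within B)"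
        if "s \<in> B" "t \<in> B" for s t using f2 that by (rule D2)
      show "((\<lambda>t. \<alpha> (Q s t)) has_real_derivative \<alpha>' (Q s t)) (at t within B)"
        if "s \<in> B" "t \<in> B" for s t using \<alpha>2 that by (rule D2)
      show "((\<lambda>s. m (Q s t)) has_real_derivative k (Q s t)) (at s within B)"
        if "s \<in> B" "t \<in> B" for s t using m1 that by (rule D1)
      show "((\<lambda>t. k (Q s t)) has_real_derivative l (Q s t)) (at t within B)"
        if "s \<in> B" "t \<in> B" for s t using k2 that by (rule D2)
    qed (fact Qc[OF cont(1)] Qc[OF cont(2)] Qc[OF cont(3)] Qc[OF cont(4)] Qc[OF cont(5)])+
    then obtain n where n: "continuous_on (B \<times> B) (\<lambda>(s, t). n s t)"
      "\<And>s t. s \<in> B \<Longrightarrow> t \<in> B \<Longrightarrow> ((\<lambda>t. m (Q s t)) has_real_derivative n s t) (at t within B)" by blast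
    let ?c = "\<lambda>i q. (q - p) $ i"
    let ?M = "ball p \<delta>" and ?n = "\<lambda>q. n (?c 1 q) (?c 2 q)"
    have cM: "\<bar>?c i q\<bar> < \<delta>" if "q \<in> ?M" for i q
      using component_le_norm_cart[of "q - p" i] that by (simp add: dist_norm norm_minus_commute)
    then have cB: "?c i q \<in> B" if "q \<in> ?M" for i q using that[THEN cM, of i] by (auto simp: B_def)
    have "has_partial 2 m (?n q) q" if q: "q \<in> ?M" for q
    proof -
      have Qq: "Q (?c 1 q) (h + ?c 2 q) = q + h *\<^sub>R axis 2 1" for h
        by (simp add: Q_def vec_eq_iff forall_2 axis_def)
      \<comment> \<open>At the ends of \<open>B\<close> the derivative within \<open>B\<close> is
        only one-sided; on the open ball of radius \<delta> the coordinates are interior and it is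
        two-sided.\<close>
      have "?c 2 q \<in> interior B" using cM[OF q, of 2] by (auto simp: B_def)
      then have "((\<lambda>t. m (Q (?c 1 q) t)) has_real_derivative ?n q) (at (?c 2 q))"
        using n(2)[OF cB[OF q] cB[OF q], of 1 2] by (simp add: at_within_interior[of _ B])
      then show ?thesis
        using DERIV_shift[of "\<lambda>t. m (Q (?c 1 q) t)" "?n q" 0 "?c 2 q"]
        unfolding has_partial_def Qq add_0_left by blast
    qed
    moreover have "continuous_on ?M (\<lambda>q. case (?c 1 q, ?c 2 q) of (s, t) \<Rightarrow> n s t)"
      by (rule continuous_on_compose2[OF n(1)]) (use cB in \<open>auto intro!: continuous_intros\<close>)
    then have cn: "continuous_on ?M ?n" by simp
    moreover have "?M \<subseteq> N" using d by (auto simp: \<delta>_def subset_eq)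
    ultimately show ?thesis using \<delta> cn by (intro exI[of _ ?n] exI[of _ ?M]) auto
  qed
  \<comment> \<open>By uniqueness this choice agrees with every local candidate and inherits its
    continuity.\<close>
  define n where "n q = (SOME d. has_partial 2 m d q)" for q
  have n: "has_partial 2 m (n q) q" if "q \<in> N" for q
    unfolding n_def using local[OF that] by (metis someI_ex)
  have "isCont n p" if p: "p \<in> N" for p
  proof -
    obtain n' M where M: "open M" "p \<in> M" "M \<subseteq> N" "continuous_on M n'" "\<And>q. q \<in> M \<Longrightarrow> has_partial 2 m (n' q) q"
      using local[OF p] by blast
    have "n q = n' q" if "q \<in> M" for q
      using has_partial_unique[OF n M(5)] M(3) that by blast
    then have "continuous_on M n" using M(4) by (simp cong: continuous_on_cong)
    then show ?thesis using M by (simp add: continuous_on_eq_continuous_at)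
  qed
  then have "continuous_on N n" by (simp add: continuous_at_imp_continuous_on)
  then show ?thesis using n that by blast
qed

section \<open>Calculus of partial derivatives\<close>

lemma partial_const [simp]: "partial a (\<lambda>_. c) p = 0"
  by (simp add: partial_eqI[OF has_derivative_const])

lemma
  fixes f g :: "real^2 \<Rightarrow> real"
  assumes "f differentiable (at p)" "g differentiable (at p)"
  shows partial_add: "partial a (\<lambda>q. f q + g q) p = partial a f p + partial a g p"
    and partial_diff: "partial a (\<lambda>q. f q - g q) p = partial a f p - partial a g p"
    and partial_mult: "partial a (\<lambda>q. f q * g q) p = partial a f p * g p + f p * partial a g p"
  using assms by (intro has_partial_imp_partial derivative_intros has_partial_partial partial_intros; simp)+

lemma
  fixes f :: "real^2 \<Rightarrow> real"
  assumes "f differentiable (at p)"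
  shows partial_minus: "partial a (\<lambda>q. - f q) p = - partial a f p"
    and partial_square: "partial a (\<lambda>q. (f q)\<^sup>2) p = 2 * f p * partial a f p"
  using assms by (intro has_partial_imp_partial derivative_intros has_partial_partial partial_intros; simp)+

lemma partial_nth:
  fixes W :: "real^2 \<Rightarrow> real^'n"
  assumes "W differentiable (at p)"
  shows "partial a W p $ i = partial a (\<lambda>q. W q $ i) p"
proof -
  have "(W has_derivative frechet_derivative W (at p)) (at p)"
    using frechet_derivative_works[THEN iffD1, OF assms] .
  then have "((\<lambda>q. W q $ i) has_derivative (\<lambda>h. frechet_derivative W (at p) h $ i)) (at p)"
    by (rule bounded_linear.has_derivative[OF bounded_linear_vec_nth])
  from partial_eqI[OF this, of a] show ?thesis by (simp add: partial_def)
qed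

lemma
  fixes f :: "real^2 \<Rightarrow> real"
  assumes "f differentiable (at p)"
  shows differentiable_divide_const: "(\<lambda>q. f q / c) differentiable (at p)"
    and partial_divide_const: "partial a (\<lambda>q. f q / c) p = partial a f p / c"
  using assms partial_mult[of f p "\<lambda>_. inverse c" a] by (simp_all add: divide_inverse)

lemmas partial_simps = partial_add partial_diff partial_mult partial_minus partial_square
  partial_divide_const differentiable_divide_const
  differentiable_add differentiable_diff differentiable_mult differentiable_minus differentiable_power
  differentiable_const

section \<open>Closure properties of C^k functions\<close>

lemma Ck_on_imp_continuous: "Ck_on k f U \<Longrightarrow> continuous_on U f"
proof (cases k)
  case (Suc j)
  assume "Ck_on k f U"
  then have "isCont f p" if "p \<in> U" for p
    using that Suc by (intro differentiable_imp_continuous_within) simp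
  then show ?thesis by (intro continuous_at_imp_continuous_on) blast
qed simp

lemma Ck_on_SucD: "Ck_on (Suc k) f U \<Longrightarrow> Ck_on k f U"
proof (induction k arbitrary: f)
  case 0
  then show ?case unfolding Ck_on.simps(1) by (rule Ck_on_imp_continuous)
qed auto

lemma Ck_on_mono: "j \<le> k \<Longrightarrow> Ck_on k f U \<Longrightarrow> Ck_on j f U"
  by (induction rule: dec_induct) (auto dest: Ck_on_SucD simp del: Ck_on.simps)

lemma Ck_on_subset: "Ck_on k f U \<Longrightarrow> V \<subseteq> U \<Longrightarrow> Ck_on k f V"
  by (induction k arbitrary: f) (auto intro: continuous_on_subset)

lemma Ck_on_partial: "Ck_on (Suc k) f U \<Longrightarrow> Ck_on k (partial a f) U"
  by simp

lemma Ck_on_differentiable: "Ck_on k f U \<Longrightarrow> 0 < k \<Longrightarrow> p \<in> U \<Longrightarrow> f differentiable (at p)"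
  by (cases k) auto

lemma Ck_on_cong:
  assumes "open U" "\<And>q. q \<in> U \<Longrightarrow> f q = g q" "Ck_on k f U"
  shows "Ck_on k g U"
  using assms(2,3)
proof (induction k arbitrary: f g)
  case 0
  then show ?case by (simp cong: continuous_on_cong)
next
  case (Suc k)
  have "g differentiable (at p)" if "p \<in> U" for p
    using differentiable_cong_open[OF assms(1) that Suc.prems(1)] Suc.prems(2) that by simp
  moreover have "Ck_on k (partial a g) U" for a
    by (rule Suc.IH[of "partial a f"])
      (use Suc.prems partial_cong[OF assms(1) _ Suc.prems(1)] in auto)
  ultimately show ?case by simp
qed

named_theorems Ck_intros

lemma Ck_on_const [Ck_intros]: "Ck_on k (\<lambda>_. c) U"
  by (induction k arbitrary: c) (auto simp: partial_const[abs_def])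

lemma Ck_on_add [Ck_intros]:
  assumes U: "open U" and f: "Ck_on k f U" and g: "Ck_on k g U"
  shows "Ck_on k (\<lambda>q. f q + g q) U"
  using f g
proof (induction k arbitrary: f g)
  case (Suc k)
  have "Ck_on k (partial a (\<lambda>q. f q + g q)) U" for a
    by (rule Ck_on_cong[OF U, of "\<lambda>q. partial a f q + partial a g q"])
      (use Suc in \<open>auto simp: partial_add\<close>)
  then show ?case using Suc.prems by auto
qed (auto intro: continuous_intros)

lemma Ck_on_mult [Ck_intros]:
  assumes U: "open U" and f: "Ck_on k f U" and g: "Ck_on k g U"
  shows "Ck_on k (\<lambda>q. f q * g q) U"
  using f g
proof (induction k arbitrary: f g)
  case (Suc k)
  have "Ck_on k (\<lambda>q. partial a f q * g q + f q * partial a g q) U" for a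
    using Suc.prems by (intro Ck_on_add[OF U] Suc.IH) (auto dest: Ck_on_SucD simp del: Ck_on.simps intro: Ck_on_partial)
  then have "Ck_on k (partial a (\<lambda>q. f q * g q)) U" for a
    by (rule Ck_on_cong[OF U, rotated]) (use Suc.prems in \<open>auto simp: partial_mult\<close>)
  then show ?case using Suc.prems by auto
qed (auto intro: continuous_intros)

lemma Ck_on_minus [Ck_intros]: "open U \<Longrightarrow> Ck_on k f U \<Longrightarrow> Ck_on k (\<lambda>q. - f q) U"
  using Ck_on_mult[of U k "\<lambda>_. -1" f] by (simp add: Ck_on_const)

lemma Ck_on_diff [Ck_intros]:
  "open U \<Longrightarrow> Ck_on k f U \<Longrightarrow> Ck_on k g U \<Longrightarrow> Ck_on k (\<lambda>q. f q - g q) U"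
  using Ck_on_add[of U k f "\<lambda>q. - g q"] by (simp add: Ck_on_minus)

lemma Ck_on_square [Ck_intros]: "open U \<Longrightarrow> Ck_on k f U \<Longrightarrow> Ck_on k (\<lambda>q. (f q)\<^sup>2) U"
  by (simp add: power2_eq_square Ck_on_mult)

lemma Ck_on_has_partial: "Ck_on k f U \<Longrightarrow> 0 < k \<Longrightarrow> p \<in> U \<Longrightarrow> has_partial a f (partial a f p) p"
  by (intro has_partial_partial Ck_on_differentiable)

text \<open>Schwarz's theorem: \<open>has_partial_swap\<close> shows that the mixed derivative taken
  in one order is also the directional derivative that defines the other order.\<close>

lemma partial_commute:
  assumes U: "open U" "p \<in> U" and f: "Ck_on 2 f U"
  shows "partial b (partial a f) p = partial a (partial b f) p"
proof (rule has_partial_unique[OF _ Ck_on_has_partial[of 1]])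
  have 1: "Ck_on 1 f U" "\<And>c. Ck_on 1 (partial c f) U" "\<And>c d. Ck_on 0 (partial d (partial c f)) U"
    using f Ck_on_SucD[of 1 f U] by (auto simp: numeral_2_eq_2 simp del: Ck_on.simps(1))
  show "has_partial a (partial b f) (partial b (partial a f) p) p"
    by (rule has_partial_swap[OF U, where f = f and u = "partial a f" and b = b])
      (use 1 in \<open>auto intro: Ck_on_has_partial Ck_on_imp_continuous simp del: Ck_on.simps\<close>)
  show "Ck_on 1 (partial b f) U" by fact
qed (use U in auto)

text \<open>Returns from directional derivatives, as delivered by \<open>has_partial_swap\<close>
  and \<open>has_partial_gain\<close>, to the Frechet derivatives on which \<open>Ck_on\<close> is
  built.\<close>

lemma C1_from_partials:
  assumes N: "open N" and f: "\<And>q. q \<in> N \<Longrightarrow> has_partial 1 f (f1 q) q" "\<And>q. q \<in> N \<Longrightarrow> has_partial 2 f (f2 q) q"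
    and c: "continuous_on N f1" "continuous_on N f2"
  shows "Ck_on 1 f N"
proof -
  have D: "f differentiable (at q)" if "q \<in> N" for q
    using partials_imp_differentiable[OF N that f c] .
  have "partial 1 f q = f1 q" "partial 2 f q = f2 q" if "q \<in> N" for q
    using has_partial_imp_partial[OF D[OF that]] f that by auto
  then have "continuous_on N (partial a f)" for a
    using c exhaust_2[of a] by (auto cong: continuous_on_cong)
  then show ?thesis using D by simp
qed

section \<open>Curvature of the prolongation connection\<close>

locale projective_coefficients =
  fixes \<Gamma> :: connection and N :: "(real^2) set"
  assumes open_N: "open N"
    and C5: "Ck_on 5 (A0 \<Gamma>) N" "Ck_on 5 (A1 \<Gamma>) N" "Ck_on 5 (A2 \<Gamma>) N" "Ck_on 5 (A3 \<Gamma>) N"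
begin

lemma C4: "Ck_on 4 (partial a (A0 \<Gamma>)) N" "Ck_on 4 (partial a (A1 \<Gamma>)) N"
  "Ck_on 4 (partial a (A2 \<Gamma>)) N" "Ck_on 4 (partial a (A3 \<Gamma>)) N"
  using C5 by (auto simp: eval_nat_numeral simp del: Ck_on.simps intro: Ck_on_partial)

lemma C3: "Ck_on 3 (partial b (partial a (A0 \<Gamma>))) N" "Ck_on 3 (partial b (partial a (A1 \<Gamma>))) N"
  "Ck_on 3 (partial b (partial a (A2 \<Gamma>))) N" "Ck_on 3 (partial b (partial a (A3 \<Gamma>))) N"
  using C4 by (auto simp: eval_nat_numeral simp del: Ck_on.simps intro: Ck_on_partial)

lemmas Ck_jets = C5 C4 C3

lemmas jets_differentiable = Ck_jets[THEN Ck_on_differentiable, simplified]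

lemmas jets_has_partial = Ck_jets[THEN Ck_on_has_partial, simplified]

lemmas jets_continuous = Ck_jets[THEN Ck_on_imp_continuous]
  Ck_jets[THEN Ck_on_mono[of 1, rotated], simplified, THEN conjunct2, THEN spec]

text \<open>Orients mixed derivatives towards a normal form with the x-derivatives outermost, so
  that jets can be compared as atoms of a polynomial identity.\<close>

lemma partial_2_1:
  assumes "Ck_on k f N" "2 \<le> k" "p \<in> N"
  shows "partial 2 (partial 1 f) p = partial 1 (partial 2 f) p"
  using partial_commute[OF open_N assms(3)] Ck_on_mono assms by blast

text \<open>The two mixed derivatives are known to agree on \<open>N\<close> only, so rewriting
  below a further derivative appeals to locality.\<close>

lemma partial_2_1_inner:
  assumes "Ck_on k f N" "2 \<le> k" "p \<in> N"
  shows "partial b (partial 2 (partial 1 f)) p = partial b (partial 1 (partial 2 f)) p"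
  by (rule partial_cong[OF open_N assms(3)]) (rule partial_2_1[OF assms(1,2)])

lemmas jets_commute = C5[THEN partial_2_1, simplified] C4[THEN partial_2_1, simplified]
  C5[THEN partial_2_1_inner, simplified]

lemmas coefficients_abs = a41_def[of \<Gamma>, abs_def] a42_def[of \<Gamma>, abs_def] a43_def[of \<Gamma>, abs_def]
  a61_def[of \<Gamma>, abs_def] a62_def[of \<Gamma>, abs_def] a63_def[of \<Gamma>, abs_def] a64_def[of \<Gamma>, abs_def] a65_def[of \<Gamma>, abs_def]
  b51_def[of \<Gamma>, abs_def] b52_def[of \<Gamma>, abs_def] b53_def[of \<Gamma>, abs_def]
  b61_def[of \<Gamma>, abs_def] b62_def[of \<Gamma>, abs_def] b63_def[of \<Gamma>, abs_def] b64_def[of \<Gamma>, abs_def] b65_def[of \<Gamma>, abs_def]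

lemma Ck_L: "Ck_on 3 (L1 \<Gamma>) N" "Ck_on 3 (L2 \<Gamma>) N"
  unfolding L1_def[abs_def] L2_def[abs_def]
  by (intro Ck_intros open_N Ck_jets Ck_jets[THEN Ck_on_mono[rotated]]; simp)+

lemma Ck_coefficients:
  "Ck_on 3 (a41 \<Gamma>) N" "Ck_on 3 (a42 \<Gamma>) N" "Ck_on 3 (a43 \<Gamma>) N"
  "Ck_on 3 (a61 \<Gamma>) N" "Ck_on 3 (a62 \<Gamma>) N" "Ck_on 3 (a63 \<Gamma>) N" "Ck_on 3 (a64 \<Gamma>) N" "Ck_on 3 (a65 \<Gamma>) N"
  "Ck_on 3 (b51 \<Gamma>) N" "Ck_on 3 (b52 \<Gamma>) N" "Ck_on 3 (b53 \<Gamma>) N"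
  "Ck_on 3 (b61 \<Gamma>) N" "Ck_on 3 (b62 \<Gamma>) N" "Ck_on 3 (b63 \<Gamma>) N" "Ck_on 3 (b64 \<Gamma>) N" "Ck_on 3 (b65 \<Gamma>) N"
  unfolding coefficients_abs
  by (intro Ck_intros open_N Ck_jets Ck_jets[THEN Ck_on_mono[rotated]]; simp)+

lemmas coefficients_differentiable = Ck_coefficients[THEN Ck_on_differentiable, simplified]

lemmas coefficients_has_partial = Ck_coefficients[THEN Ck_on_has_partial, simplified]

lemmas coefficients_continuous = Ck_coefficients[THEN Ck_on_imp_continuous]
  Ck_coefficients[THEN Ck_on_mono[of 1, rotated], simplified, THEN conjunct2, THEN spec]

text \<open>The last row of \<open>\<partial>\<^sub>y \<Omega>\<^sub>1 - \<Omega>\<^sub>1 \<Omega>\<^sub>2 - \<partial>\<^sub>x \<Omega>\<^sub>2 + \<Omega>\<^sub>2 \<Omega>\<^sub>1\<close>, column by column.\<close>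
lemma curvature_1:
  assumes "p \<in> N"
  shows "partial 2 (a61 \<Gamma>) p - (a61 \<Gamma> p * (-4/3 * A2 \<Gamma> p) + a65 \<Gamma> p * b51 \<Gamma> p - 1/3 * A1 \<Gamma> p * b61 \<Gamma> p)
    - partial 1 (b61 \<Gamma>) p
    + (b61 \<Gamma> p * (-2/3 * A1 \<Gamma> p) + b63 \<Gamma> p * (-2 * A3 \<Gamma> p) + b64 \<Gamma> p * a41 \<Gamma> p + 1/3 * A2 \<Gamma> p * a61 \<Gamma> p)
    = - \<V> \<Gamma> p $ 1"
proof -
  have V: "- \<V> \<Gamma> p $ 1 = - (2 * \<partial>\<^sub>y (L2 \<Gamma>) p + 4 * A2 \<Gamma> p * L2 \<Gamma> p + 8 * A3 \<Gamma> p * L1 \<Gamma> p)"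
    by (simp add: \<V>_def vector_6)
  show ?thesis unfolding V unfolding coefficients_abs L1_def[of \<Gamma>, abs_def] L2_def[of \<Gamma>, abs_def]
    \<comment> \<open>Once derivatives are distributed and mixed ones put in normal form, a
      polynomial identity in the jets remains.\<close>
    by (simp add: partial_simps jets_differentiable jets_commute assms power2_eq_square) (simp add: field_simps)
qed

lemma curvature_2:
  assumes "p \<in> N"
  shows "partial 2 (a62 \<Gamma>) p - (a61 \<Gamma> p * (2/3 * A1 \<Gamma> p) + a63 \<Gamma> p * (-2 * A3 \<Gamma> p) + a65 \<Gamma> p * b52 \<Gamma> p - 1/3 * A1 \<Gamma> p * b62 \<Gamma> p)
    - partial 1 (b62 \<Gamma>) p
    + (b61 \<Gamma> p * (2 * A0 \<Gamma> p) + b63 \<Gamma> p * (-2/3 * A2 \<Gamma> p) + b64 \<Gamma> p * a42 \<Gamma> p + 1/3 * A2 \<Gamma> p * a62 \<Gamma> p)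
    = - \<V> \<Gamma> p $ 2"
proof -
  have V: "- \<V> \<Gamma> p $ 2 = - (- 2 * \<partial>\<^sub>y (L1 \<Gamma>) p - 2 * \<partial>\<^sub>x (L2 \<Gamma>) p - 4/3 * A1 \<Gamma> p * L2 \<Gamma> p + 4/3 * A2 \<Gamma> p * L1 \<Gamma> p)"
    by (simp add: \<V>_def vector_6)
  show ?thesis unfolding V unfolding coefficients_abs L1_def[of \<Gamma>, abs_def] L2_def[of \<Gamma>, abs_def]
    by (simp add: partial_simps jets_differentiable jets_commute assms power2_eq_square) (simp add: field_simps)
qed

lemma curvature_3:
  assumes "p \<in> N"
  shows "partial 2 (a63 \<Gamma>) p - (a61 \<Gamma> p * (2 * A0 \<Gamma> p) + a63 \<Gamma> p * (2/3 * A2 \<Gamma> p) + a65 \<Gamma> p * b53 \<Gamma> p - 1/3 * A1 \<Gamma> p * b63 \<Gamma> p)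
    - partial 1 (b63 \<Gamma>) p
    + (b63 \<Gamma> p * (4/3 * A1 \<Gamma> p) + b64 \<Gamma> p * a43 \<Gamma> p + 1/3 * A2 \<Gamma> p * a63 \<Gamma> p)
    = - \<V> \<Gamma> p $ 3"
proof -
  have V: "- \<V> \<Gamma> p $ 3 = - (2 * \<partial>\<^sub>x (L1 \<Gamma>) p - 8 * A0 \<Gamma> p * L2 \<Gamma> p - 4 * A1 \<Gamma> p * L1 \<Gamma> p)"
    by (simp add: \<V>_def vector_6)
  show ?thesis unfolding V unfolding coefficients_abs L1_def[of \<Gamma>, abs_def] L2_def[of \<Gamma>, abs_def]
    by (simp add: partial_simps jets_differentiable jets_commute assms power2_eq_square) (simp add: field_simps)
qed

lemma curvature_4:
  assumes "p \<in> N"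
  shows "partial 2 (a64 \<Gamma>) p - (a61 \<Gamma> p + a65 \<Gamma> p * (3 * A3 \<Gamma> p) - 1/3 * A1 \<Gamma> p * b64 \<Gamma> p)
    - partial 1 (b64 \<Gamma>) p
    + (b62 \<Gamma> p * (-1/2) + b64 \<Gamma> p * (-1/3 * A1 \<Gamma> p) + 1/3 * A2 \<Gamma> p * a64 \<Gamma> p)
    = - \<V> \<Gamma> p $ 4"
proof -
  have V: "- \<V> \<Gamma> p $ 4 = - (- 5 * L2 \<Gamma> p)"
    by (simp add: \<V>_def vector_6)
  show ?thesis unfolding V unfolding coefficients_abs L1_def[of \<Gamma>, abs_def] L2_def[of \<Gamma>, abs_def]
    by (simp add: partial_simps jets_differentiable jets_commute assms power2_eq_square) (simp add: field_simps)
qed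

lemma curvature_5:
  assumes "p \<in> N"
  shows "partial 2 (a65 \<Gamma>) p - (a62 \<Gamma> p * (-1/2) + a65 \<Gamma> p * (1/3 * A2 \<Gamma> p) - 1/3 * A1 \<Gamma> p * b65 \<Gamma> p)
    - partial 1 (b65 \<Gamma>) p
    + (b63 \<Gamma> p + b64 \<Gamma> p * (-3 * A0 \<Gamma> p) + 1/3 * A2 \<Gamma> p * a65 \<Gamma> p)
    = - \<V> \<Gamma> p $ 5"
proof -
  have V: "- \<V> \<Gamma> p $ 5 = - (- 5 * L1 \<Gamma> p)"
    by (simp add: \<V>_def vector_6)
  show ?thesis unfolding V unfolding coefficients_abs L1_def[of \<Gamma>, abs_def] L2_def[of \<Gamma>, abs_def]
    by (simp add: partial_simps jets_differentiable jets_commute assms power2_eq_square) (simp add: field_simps)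
qed

end

section \<open>Regularity of solutions of Liouville's system\<close>

text \<open>Put \<Phi> = \<psi>1 + 2 \<psi>2 z + \<psi>3 z^2 with z = y', and let f be the cubic
  with coefficients A0, ..., A3. The equations are the coefficients of 1, z^3, z and z^2, in this
  order, in d\<Phi>/dx = 2/3 f'(z) \<Phi> along the geodesics y'' = f(z); those of z^4
  cancel.\<close>

locale liouville_solution = projective_coefficients +
  fixes \<psi>1 \<psi>2 \<psi>3 :: "real^2 \<Rightarrow> real"
  assumes C1_\<psi>: "Ck_on 1 \<psi>1 N" "Ck_on 1 \<psi>2 N" "Ck_on 1 \<psi>3 N"
    and \<psi>1_x: "p \<in> N \<Longrightarrow> \<partial>\<^sub>x \<psi>1 p = 2/3 * A1 \<Gamma> p * \<psi>1 p - 2 * A0 \<Gamma> p * \<psi>2 p"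
    and \<psi>3_y: "p \<in> N \<Longrightarrow> \<partial>\<^sub>y \<psi>3 p = 2 * A3 \<Gamma> p * \<psi>2 p - 2/3 * A2 \<Gamma> p * \<psi>3 p"
    and \<psi>1_y: "p \<in> N \<Longrightarrow> \<partial>\<^sub>y \<psi>1 p + 2 * \<partial>\<^sub>x \<psi>2 p
      = 4/3 * A2 \<Gamma> p * \<psi>1 p - 2/3 * A1 \<Gamma> p * \<psi>2 p - 2 * A0 \<Gamma> p * \<psi>3 p"
    and \<psi>3_x: "p \<in> N \<Longrightarrow> \<partial>\<^sub>x \<psi>3 p + 2 * \<partial>\<^sub>y \<psi>2 p
      = 2 * A3 \<Gamma> p * \<psi>1 p - 4/3 * A1 \<Gamma> p * \<psi>3 p + 2/3 * A2 \<Gamma> p * \<psi>2 p"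
begin

definition \<mu> :: "real^2 \<Rightarrow> real" where "\<mu> p = 2 * \<partial>\<^sub>x \<psi>2 p"
definition \<nu> :: "real^2 \<Rightarrow> real" where "\<nu> p = 2 * \<partial>\<^sub>y \<psi>2 p"

lemma continuous_\<psi>: "continuous_on N \<psi>1" "continuous_on N \<psi>2" "continuous_on N \<psi>3"
  "continuous_on N (partial a \<psi>1)" "continuous_on N (partial a \<psi>2)" "continuous_on N (partial a \<psi>3)"
  "continuous_on N \<mu>" "continuous_on N \<nu>"
proof -
  show *: "continuous_on N \<psi>1" "continuous_on N \<psi>2" "continuous_on N \<psi>3"
    using C1_\<psi>[THEN Ck_on_imp_continuous] .
  show **: "continuous_on N (partial a \<psi>1)" "continuous_on N (partial a \<psi>2)" "continuous_on N (partial a \<psi>3)" for a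
    using C1_\<psi> by simp_all
  show "continuous_on N \<mu>" "continuous_on N \<nu>"
    unfolding \<mu>_def[abs_def] \<nu>_def[abs_def] by (intro continuous_intros **)+
qed

text \<open>Four equations for six first derivatives leave two of them free; \<mu> and \<nu>
  parametrise these.\<close>

lemma \<psi>_has_partial:
  assumes "p \<in> N"
  shows "has_partial 1 \<psi>1 (2/3 * A1 \<Gamma> p * \<psi>1 p - 2 * A0 \<Gamma> p * \<psi>2 p) p"
    and "has_partial 2 \<psi>1 (4/3 * A2 \<Gamma> p * \<psi>1 p - 2/3 * A1 \<Gamma> p * \<psi>2 p - 2 * A0 \<Gamma> p * \<psi>3 p - \<mu> p) p"
    and "has_partial 1 \<psi>2 (1/2 * \<mu> p) p"
    and "has_partial 2 \<psi>2 (1/2 * \<nu> p) p"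
    and "has_partial 1 \<psi>3 (2 * A3 \<Gamma> p * \<psi>1 p - 4/3 * A1 \<Gamma> p * \<psi>3 p + 2/3 * A2 \<Gamma> p * \<psi>2 p - \<nu> p) p"
    and "has_partial 2 \<psi>3 (2 * A3 \<Gamma> p * \<psi>2 p - 2/3 * A2 \<Gamma> p * \<psi>3 p) p"
proof -
  have h: "has_partial a \<psi>1 (partial a \<psi>1 p) p" "has_partial a \<psi>2 (partial a \<psi>2 p) p"
    "has_partial a \<psi>3 (partial a \<psi>3 p) p" for a
    using C1_\<psi> assms by (auto intro: has_partial_partial)
  show "has_partial 1 \<psi>1 (2/3 * A1 \<Gamma> p * \<psi>1 p - 2 * A0 \<Gamma> p * \<psi>2 p) p"
    using h(1)[of 1] \<psi>1_x[OF assms] by simp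
  show "has_partial 2 \<psi>1 (4/3 * A2 \<Gamma> p * \<psi>1 p - 2/3 * A1 \<Gamma> p * \<psi>2 p - 2 * A0 \<Gamma> p * \<psi>3 p - \<mu> p) p"
    using \<psi>1_y[OF assms] by (intro has_partial_eq_rhs[OF h(1)[of 2]]) (simp add: \<mu>_def)
  show "has_partial 1 \<psi>2 (1/2 * \<mu> p) p" "has_partial 2 \<psi>2 (1/2 * \<nu> p) p"
    using h(2) by (simp_all add: \<mu>_def \<nu>_def)
  show "has_partial 1 \<psi>3 (2 * A3 \<Gamma> p * \<psi>1 p - 4/3 * A1 \<Gamma> p * \<psi>3 p + 2/3 * A2 \<Gamma> p * \<psi>2 p - \<nu> p) p"
    using \<psi>3_x[OF assms] by (intro has_partial_eq_rhs[OF h(3)[of 1]]) (simp add: \<nu>_def)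
  show "has_partial 2 \<psi>3 (2 * A3 \<Gamma> p * \<psi>2 p - 2/3 * A2 \<Gamma> p * \<psi>3 p) p"
    using h(3)[of 2] \<psi>3_y[OF assms] by simp
qed

lemma \<psi>_partial:
  assumes "p \<in> N"
  shows "partial 1 \<psi>1 p = 2/3 * A1 \<Gamma> p * \<psi>1 p - 2 * A0 \<Gamma> p * \<psi>2 p"
    and "partial 2 \<psi>1 p = 4/3 * A2 \<Gamma> p * \<psi>1 p - 2/3 * A1 \<Gamma> p * \<psi>2 p - 2 * A0 \<Gamma> p * \<psi>3 p - \<mu> p"
    and "partial 1 \<psi>2 p = 1/2 * \<mu> p"
    and "partial 2 \<psi>2 p = 1/2 * \<nu> p"
    and "partial 1 \<psi>3 p = 2 * A3 \<Gamma> p * \<psi>1 p - 4/3 * A1 \<Gamma> p * \<psi>3 p + 2/3 * A2 \<Gamma> p * \<psi>2 p - \<nu> p"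
    and "partial 2 \<psi>3 p = 2 * A3 \<Gamma> p * \<psi>2 p - 2/3 * A2 \<Gamma> p * \<psi>3 p"
  using C1_\<psi>[THEN Ck_on_differentiable, of p, simplified, OF assms] \<psi>_has_partial[OF assms]
  by (blast intro: has_partial_imp_partial)+

text \<open>The fourth entry of \<open>- \<Omega>1 \<Psi>\<close>; likewise \<open>\<nu>y\<close> is
  the fifth entry of \<open>- \<Omega>2 \<Psi>\<close>.\<close>

definition \<mu>x :: "real^2 \<Rightarrow> real" where
  "\<mu>x p = - (a41 \<Gamma> p * \<psi>1 p + a42 \<Gamma> p * \<psi>2 p + a43 \<Gamma> p * \<psi>3 p - 1/3 * A1 \<Gamma> p * \<mu> p - 3 * A0 \<Gamma> p * \<nu> p)"

definition \<nu>y :: "real^2 \<Rightarrow> real" where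
  "\<nu>y p = - (b51 \<Gamma> p * \<psi>1 p + b52 \<Gamma> p * \<psi>2 p + b53 \<Gamma> p * \<psi>3 p + 3 * A3 \<Gamma> p * \<mu> p + 1/3 * A2 \<Gamma> p * \<nu> p)"

text \<open>The x-derivative of \<psi>1 equals an expression differentiable in y, so by
  \<open>has_partial_swap\<close> the y-derivative of \<psi>1 is differentiable in x. By
  \<open>\<psi>1_y\<close>, \<mu> differs from its negative only by terms differentiable in
  x.\<close>

lemma has_partial_\<mu>_1:
  assumes p: "p \<in> N"
  shows "has_partial 1 \<mu> (\<mu>x p) p"
proof -
  let ?w = "\<lambda>q. 2/3 * (partial 2 (A1 \<Gamma>) q * \<psi>1 q + A1 \<Gamma> q * partial 2 \<psi>1 q)
    - 2 * (partial 2 (A0 \<Gamma>) q * \<psi>2 q + A0 \<Gamma> q * (1/2 * \<nu> q))"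
  have \<psi>12: "has_partial 2 \<psi>1 (partial 2 \<psi>1 q) q" if "q \<in> N" for q
    using C1_\<psi> that by (auto intro: has_partial_partial)
  have swap: "has_partial 1 (partial 2 \<psi>1) (?w p) p"
  proof (rule has_partial_swap[OF open_N p \<psi>_has_partial(1) \<psi>12])
    show "has_partial 2 (\<lambda>q. 2/3 * A1 \<Gamma> q * \<psi>1 q - 2 * A0 \<Gamma> q * \<psi>2 q) (?w q) q" if "q \<in> N" for q
      by (rule has_partial_eq_rhs, (rule partial_intros jets_has_partial[OF that] \<psi>12[OF that] \<psi>_has_partial[OF that])+)
        (simp add: algebra_simps)
    show "continuous_on N ?w" by (intro continuous_intros jets_continuous continuous_\<psi>)
  qed
  have "has_partial 1 (\<lambda>q. 4/3 * A2 \<Gamma> q * \<psi>1 q - 2/3 * A1 \<Gamma> q * \<psi>2 q - 2 * A0 \<Gamma> q * \<psi>3 q - partial 2 \<psi>1 q) (\<mu>x p) p"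
    by (rule has_partial_eq_rhs, (rule partial_intros jets_has_partial[OF p] \<psi>_has_partial[OF p] swap)+)
      (simp add: \<psi>_partial[OF p] \<mu>x_def a41_def a42_def a43_def field_simps power2_eq_square)
  then show ?thesis
    by (rule has_partial_cong[OF open_N p, rotated]) (use \<psi>1_y in \<open>simp add: \<mu>_def algebra_simps\<close>)
qed

text \<open>The same argument with x and y exchanged, starting from \<psi>3.\<close>

lemma has_partial_\<nu>_2:
  assumes p: "p \<in> N"
  shows "has_partial 2 \<nu> (\<nu>y p) p"
proof -
  let ?w = "\<lambda>q. 2 * (partial 1 (A3 \<Gamma>) q * \<psi>2 q + A3 \<Gamma> q * (1/2 * \<mu> q))
    - 2/3 * (partial 1 (A2 \<Gamma>) q * \<psi>3 q + A2 \<Gamma> q * partial 1 \<psi>3 q)"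
  have \<psi>31: "has_partial 1 \<psi>3 (partial 1 \<psi>3 q) q" if "q \<in> N" for q
    using C1_\<psi> that by (auto intro: has_partial_partial)
  have swap: "has_partial 2 (partial 1 \<psi>3) (?w p) p"
  proof (rule has_partial_swap[OF open_N p \<psi>_has_partial(6) \<psi>31])
    show "has_partial 1 (\<lambda>q. 2 * A3 \<Gamma> q * \<psi>2 q - 2/3 * A2 \<Gamma> q * \<psi>3 q) (?w q) q" if "q \<in> N" for q
      by (rule has_partial_eq_rhs, (rule partial_intros jets_has_partial[OF that] \<psi>31[OF that] \<psi>_has_partial[OF that])+)
        (simp add: algebra_simps)
    show "continuous_on N ?w" by (intro continuous_intros jets_continuous continuous_\<psi>)
  qed
  have "has_partial 2 (\<lambda>q. 2 * A3 \<Gamma> q * \<psi>1 q - 4/3 * A1 \<Gamma> q * \<psi>3 q + 2/3 * A2 \<Gamma> q * \<psi>2 q - partial 1 \<psi>3 q) (\<nu>y p) p"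
    by (rule has_partial_eq_rhs, (rule partial_intros jets_has_partial[OF p] \<psi>_has_partial[OF p] swap)+)
      (simp add: \<psi>_partial[OF p] \<nu>y_def b51_def b52_def b53_def field_simps power2_eq_square)
  then show ?thesis
    by (rule has_partial_cong[OF open_N p, rotated]) (use \<psi>3_x in \<open>simp add: \<nu>_def algebra_simps\<close>)
qed

text \<open>Subtracting \<open>2/3 A\<^sub>1 \<psi>\<^sub>2\<close> from \<open>\<mu>\<close> removes the term in \<open>\<mu>\<close> from the right-hand side
  of the equation for \<open>\<partial>\<^sub>x \<mu>\<close>, so that the latter has a continuous derivative in \<open>y\<close>.\<close>
lemma \<mu>_has_partial_2:
  obtains \<rho> where "continuous_on N \<rho>" "\<And>p. p \<in> N \<Longrightarrow> has_partial 2 \<mu> (\<rho> p) p"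
proof -
  let ?m = "\<lambda>q. 1/2 * \<mu> q - 1/3 * A1 \<Gamma> q * \<psi>2 q"
  let ?k = "\<lambda>q. - 1/2 * (a41 \<Gamma> q * \<psi>1 q + a42 \<Gamma> q * \<psi>2 q + a43 \<Gamma> q * \<psi>3 q - 3 * A0 \<Gamma> q * \<nu> q)
    - 1/3 * partial 1 (A1 \<Gamma>) q * \<psi>2 q"
  let ?l = "\<lambda>q. - 1/2 * (partial 2 (a41 \<Gamma>) q * \<psi>1 q + a41 \<Gamma> q * partial 2 \<psi>1 q
      + (partial 2 (a42 \<Gamma>) q * \<psi>2 q + a42 \<Gamma> q * partial 2 \<psi>2 q)
      + (partial 2 (a43 \<Gamma>) q * \<psi>3 q + a43 \<Gamma> q * partial 2 \<psi>3 q)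
      - 3 * (partial 2 (A0 \<Gamma>) q * \<nu> q + A0 \<Gamma> q * \<nu>y q))
    - 1/3 * (partial 2 (partial 1 (A1 \<Gamma>)) q * \<psi>2 q + partial 1 (A1 \<Gamma>) q * partial 2 \<psi>2 q)"
  have \<psi>_2: "has_partial 2 \<psi>1 (partial 2 \<psi>1 q) q" "has_partial 2 \<psi>2 (partial 2 \<psi>2 q) q"
    "has_partial 2 \<psi>3 (partial 2 \<psi>3 q) q" if "q \<in> N" for q
    using C1_\<psi> that by (auto intro: has_partial_partial)
  \<comment> \<open>Here the x-derivative of \<psi>2 is split as \<mu>/2 = 1/3 A1 \<psi>2 +
    \<open>?m\<close>. Of the new unknowns only \<nu> occurs in \<open>?k\<close>, and its
    y-derivative is known from \<open>has_partial_\<nu>_2\<close>.\<close>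
  obtain n where n: "continuous_on N n" "\<And>q. q \<in> N \<Longrightarrow> has_partial 2 ?m (n q) q"
  proof (rule has_partial_gain[OF open_N, of \<psi>2 "\<lambda>q. 1/3 * A1 \<Gamma> q * \<psi>2 q" ?m "partial 2 \<psi>2"
        "\<lambda>q. 1/3 * (partial 2 (A1 \<Gamma>) q * \<psi>2 q + A1 \<Gamma> q * partial 2 \<psi>2 q)" ?k ?l])
    fix q assume q: "q \<in> N"
    show "has_partial 1 \<psi>2 (1/3 * A1 \<Gamma> q * \<psi>2 q + ?m q) q"
      by (rule has_partial_eq_rhs[OF \<psi>_has_partial(3)[OF q]]) simp
    show "has_partial 2 \<psi>2 (partial 2 \<psi>2 q) q" by (rule \<psi>_2[OF q])
    show "has_partial 2 (\<lambda>q. 1/3 * A1 \<Gamma> q * \<psi>2 q) (1/3 * (partial 2 (A1 \<Gamma>) q * \<psi>2 q + A1 \<Gamma> q * partial 2 \<psi>2 q)) q"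
      by (rule has_partial_eq_rhs, (rule partial_intros jets_has_partial[OF q] \<psi>_2[OF q])+) (simp add: field_simps)
    show "has_partial 1 ?m (?k q) q"
      by (rule has_partial_eq_rhs, (rule partial_intros jets_has_partial[OF q] \<psi>_has_partial[OF q] has_partial_\<mu>_1[OF q])+)
        (simp add: field_simps \<mu>x_def)
    show "has_partial 2 ?k (?l q) q"
      by (rule has_partial_eq_rhs, (rule partial_intros jets_has_partial[OF q]
          coefficients_has_partial[OF q] \<psi>_2[OF q] has_partial_\<nu>_2[OF q])+)
        (simp add: field_simps)
  qed (intro continuous_intros jets_continuous coefficients_continuous continuous_\<psi> | simp only: \<nu>y_def)+
  show ?thesis
  proof (rule that[of "\<lambda>q. 2 * n q + 2/3 * (partial 2 (A1 \<Gamma>) q * \<psi>2 q + A1 \<Gamma> q * partial 2 \<psi>2 q)"])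
    show "continuous_on N (\<lambda>q. 2 * n q + 2/3 * (partial 2 (A1 \<Gamma>) q * \<psi>2 q + A1 \<Gamma> q * partial 2 \<psi>2 q))"
      by (intro continuous_intros jets_continuous continuous_\<psi> n)
    fix p assume p: "p \<in> N"
    have "has_partial 2 (\<lambda>q. 2 * ?m q + 2/3 * (A1 \<Gamma> q * \<psi>2 q))
        (2 * n p + 2/3 * (partial 2 (A1 \<Gamma>) p * \<psi>2 p + A1 \<Gamma> p * partial 2 \<psi>2 p)) p"
      by (rule has_partial_eq_rhs, rule has_partial_add, rule has_partial_mult[OF has_partial_const n(2)[OF p]],
          (rule partial_intros jets_has_partial[OF p] \<psi>_2[OF p])+) (simp add: field_simps)
    then show "has_partial 2 \<mu> (2 * n p + 2/3 * (partial 2 (A1 \<Gamma>) p * \<psi>2 p + A1 \<Gamma> p * partial 2 \<psi>2 p)) p"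
      by (rule has_partial_cong[OF open_N p, rotated]) (simp add: field_simps)
  qed
qed

definition \<rho> :: "real^2 \<Rightarrow> real" where "\<rho> = partial 2 \<mu>"

text \<open>Now \<mu> has both derivatives, and they are continuous. As \<mu>/2 and \<nu>/2 are the
  derivatives of \<psi>2, swapping gives the missing x-derivative of \<nu>, which is \<rho>.\<close>

lemma C1_\<mu>: "Ck_on 1 \<mu> N"
  and C1_\<nu>: "Ck_on 1 \<nu> N"
  and \<mu>_x: "p \<in> N \<Longrightarrow> partial 1 \<mu> p = \<mu>x p"
  and \<nu>_x: "p \<in> N \<Longrightarrow> partial 1 \<nu> p = \<rho> p"
  and \<nu>_y: "p \<in> N \<Longrightarrow> partial 2 \<nu> p = \<nu>y p"
proof -
  obtain r where r: "continuous_on N r" "\<And>p. p \<in> N \<Longrightarrow> has_partial 2 \<mu> (r p) p"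
    using \<mu>_has_partial_2 by blast
  have c: "continuous_on N \<mu>x" "continuous_on N \<nu>y"
    unfolding \<mu>x_def[abs_def] \<nu>y_def[abs_def]
    by (intro continuous_intros jets_continuous coefficients_continuous continuous_\<psi>)+
  show \<mu>: "Ck_on 1 \<mu> N" by (rule C1_from_partials[OF open_N has_partial_\<mu>_1 r(2) c(1) r(1)])
  have \<rho>: "\<rho> q = r q" if "q \<in> N" for q
    unfolding \<rho>_def using \<mu> r(2) that by (auto intro: has_partial_imp_partial)
  have \<nu>1: "has_partial 1 \<nu> (r q) q" if q: "q \<in> N" for q
  proof -
    have "has_partial 1 (\<lambda>q. 1/2 * \<nu> q) (1/2 * r q) q"
    proof (rule has_partial_swap[OF open_N q, of 1 \<psi>2 "\<lambda>q. 1/2 * \<mu> q" 2 _ "\<lambda>q. 1/2 * r q"])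
      show "has_partial 2 (\<lambda>q. 1/2 * \<mu> q) (1/2 * r q) q" if "q \<in> N" for q
        using has_partial_mult[OF has_partial_const r(2)[OF that], of "1/2"] by simp
    qed (use \<psi>_has_partial r(1) in \<open>auto intro: continuous_intros\<close>)
    from has_partial_mult[OF has_partial_const this, of 2] show ?thesis by simp
  qed
  show \<nu>: "Ck_on 1 \<nu> N" by (rule C1_from_partials[OF open_N \<nu>1 has_partial_\<nu>_2 r(1) c(2)])
  show "partial 1 \<mu> p = \<mu>x p" "partial 1 \<nu> p = \<rho> p" "partial 2 \<nu> p = \<nu>y p" if "p \<in> N"
    using \<mu> \<nu> that \<nu>1 \<rho> has_partial_\<mu>_1 has_partial_\<nu>_2 by (auto intro!: has_partial_imp_partial)
qed

lemma \<Psi>_differentiable: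
  assumes "p \<in> N"
  shows "\<psi>1 differentiable (at p)" "\<psi>2 differentiable (at p)" "\<psi>3 differentiable (at p)"
    "\<mu> differentiable (at p)" "\<nu> differentiable (at p)"
  using C1_\<psi> C1_\<mu> C1_\<nu> assms by simp_all

lemma C1_\<mu>x: "Ck_on 1 \<mu>x N" and C1_\<nu>y: "Ck_on 1 \<nu>y N"
  unfolding \<mu>x_def[abs_def] \<nu>y_def[abs_def]
  by (intro Ck_intros open_N C1_\<psi> C1_\<mu> C1_\<nu>
        Ck_coefficients[THEN Ck_on_mono[rotated]] C5[THEN Ck_on_mono[rotated]]; simp)+

text \<open>\<rho> is both the y-derivative of \<mu> and the x-derivative of \<nu>. Swapping for
  \<mu> yields its x-derivative, swapping for \<nu> its y-derivative, because \<open>\<mu>x\<close>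
  and \<open>\<nu>y\<close> are C^1.\<close>

lemma \<rho>_has_partial:
  assumes p: "p \<in> N"
  shows "has_partial 1 \<rho> (partial 2 \<mu>x p) p" and "has_partial 2 \<rho> (partial 1 \<nu>y p) p"
proof -
  show "has_partial 1 \<rho> (partial 2 \<mu>x p) p"
    by (rule has_partial_swap[OF open_N p, of 1 \<mu> \<mu>x 2])
      (use C1_\<mu> C1_\<mu>x has_partial_\<mu>_1 in \<open>auto simp: \<rho>_def intro: has_partial_partial\<close>)
  have "has_partial 2 (partial 1 \<nu>) (partial 1 \<nu>y p) p"
    by (rule has_partial_swap[OF open_N p, of 2 \<nu> \<nu>y 1])
      (use C1_\<nu> C1_\<nu>y has_partial_\<nu>_2 in \<open>auto intro: has_partial_partial\<close>)
  then show "has_partial 2 \<rho> (partial 1 \<nu>y p) p"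
    using has_partial_cong[OF open_N p, of "partial 1 \<nu>" \<rho>] \<nu>_x by blast
qed

lemma C1_\<rho>: "Ck_on 1 \<rho> N"
  by (rule C1_from_partials[OF open_N \<rho>_has_partial]) (use C1_\<mu>x C1_\<nu>y in simp_all)

text \<open>The sixth row of \<open>\<Omega>1\<close> arises by differentiating
  \<open>\<mu>x\<close> in y and substituting the equations already found, including that for the
  y-derivative of \<nu>.\<close>

lemma \<rho>_x:
  assumes p: "p \<in> N"
  shows "partial 1 \<rho> p = - (a61 \<Gamma> p * \<psi>1 p + a62 \<Gamma> p * \<psi>2 p + a63 \<Gamma> p * \<psi>3 p + a64 \<Gamma> p * \<mu> p + a65 \<Gamma> p * \<nu> p
    - 1/3 * A1 \<Gamma> p * \<rho> p)"
proof -
  have "partial 1 \<rho> p = partial 2 \<mu>x p"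
    using C1_\<rho> p \<rho>_has_partial by (auto intro!: has_partial_imp_partial)
  also have "\<dots> = - (partial 2 (a41 \<Gamma>) p * \<psi>1 p + a41 \<Gamma> p * partial 2 \<psi>1 p
     + partial 2 (a42 \<Gamma>) p * \<psi>2 p + a42 \<Gamma> p * partial 2 \<psi>2 p
     + partial 2 (a43 \<Gamma>) p * \<psi>3 p + a43 \<Gamma> p * partial 2 \<psi>3 p - 1/3 * (partial 2 (A1 \<Gamma>) p * \<mu> p + A1 \<Gamma> p * \<rho> p)
     - 3 * (partial 2 (A0 \<Gamma>) p * \<nu> p + A0 \<Gamma> p * \<nu>y p))"
    unfolding \<mu>x_def[abs_def]
    by (simp add: partial_simps jets_differentiable coefficients_differentiable \<Psi>_differentiable p \<nu>_y \<rho>_def)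
  also have "\<dots> = - (a61 \<Gamma> p * \<psi>1 p + a62 \<Gamma> p * \<psi>2 p + a63 \<Gamma> p * \<psi>3 p + a64 \<Gamma> p * \<mu> p + a65 \<Gamma> p * \<nu> p
    - 1/3 * A1 \<Gamma> p * \<rho> p)"
    unfolding \<psi>_partial[OF p] \<nu>y_def coefficients_abs
    by (simp add: partial_simps jets_differentiable jets_commute p) (simp add: field_simps power2_eq_square)
  finally show ?thesis .
qed

text \<open>Dually, differentiating \<open>\<nu>y\<close> in x produces the sixth row of
  \<open>\<Omega>2\<close>; the system is then closed.\<close>

lemma \<rho>_y:
  assumes p: "p \<in> N"
  shows "partial 2 \<rho> p = - (b61 \<Gamma> p * \<psi>1 p + b62 \<Gamma> p * \<psi>2 p + b63 \<Gamma> p * \<psi>3 p + b64 \<Gamma> p * \<mu> p + b65 \<Gamma> p * \<nu> p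
    + 1/3 * A2 \<Gamma> p * \<rho> p)"
proof -
  have "partial 2 \<rho> p = partial 1 \<nu>y p"
    using C1_\<rho> p \<rho>_has_partial by (auto intro!: has_partial_imp_partial)
  also have "\<dots> = - (partial 1 (b51 \<Gamma>) p * \<psi>1 p + b51 \<Gamma> p * partial 1 \<psi>1 p
     + partial 1 (b52 \<Gamma>) p * \<psi>2 p + b52 \<Gamma> p * partial 1 \<psi>2 p
     + partial 1 (b53 \<Gamma>) p * \<psi>3 p + b53 \<Gamma> p * partial 1 \<psi>3 p + 3 * (partial 1 (A3 \<Gamma>) p * \<mu> p + A3 \<Gamma> p * \<mu>x p)
     + 1/3 * (partial 1 (A2 \<Gamma>) p * \<nu> p + A2 \<Gamma> p * \<rho> p))"
    unfolding \<nu>y_def[abs_def]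
    by (simp add: partial_simps jets_differentiable coefficients_differentiable \<Psi>_differentiable p \<mu>_x \<nu>_x)
  also have "\<dots> = - (b61 \<Gamma> p * \<psi>1 p + b62 \<Gamma> p * \<psi>2 p + b63 \<Gamma> p * \<psi>3 p + b64 \<Gamma> p * \<mu> p + b65 \<Gamma> p * \<nu> p
    + 1/3 * A2 \<Gamma> p * \<rho> p)"
    unfolding \<psi>_partial[OF p] \<mu>x_def coefficients_abs
    by (simp add: partial_simps jets_differentiable jets_commute p) (simp add: field_simps power2_eq_square)
  finally show ?thesis .
qed

end

section \<open>The parallel section and the determinant\<close>

lemma exhaust_6:
  fixes x :: 6
  shows "x = 1 \<or> x = 2 \<or> x = 3 \<or> x = 4 \<or> x = 5 \<or> x = 6"
proof (induct x)
  case (of_int z)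
  then have "0 \<le> z" "z < 6" by simp_all
  then have "z = 0 \<or> z = 1 \<or> z = 2 \<or> z = 3 \<or> z = 4 \<or> z = 5" by arith
  then show ?case by (elim disjE) simp_all
qed

lemma UNIV_6: "(UNIV :: 6 set) = {1, 2, 3, 4, 5, 6}"
  using exhaust_6 by blast

lemma sum_6: "sum f (UNIV :: 6 set) = f 1 + f 2 + f 3 + f 4 + f 5 + f 6"
  unfolding UNIV_6 by (simp add: ac_simps)

lemma forall_6: "(\<forall>i::6. P i) \<longleftrightarrow> P 1 \<and> P 2 \<and> P 3 \<and> P 4 \<and> P 5 \<and> P 6"
  unfolding ball_UNIV[symmetric, of P] UNIV_6 by simp

lemma differentiable_vec_componentwise:
  fixes W :: "real^2 \<Rightarrow> real^'n"
  assumes "\<And>i. (\<lambda>q. W q $ i) differentiable (at p)"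
  shows "W differentiable (at p)"
proof -
  have "(\<lambda>q. W q \<bullet> b) differentiable (at p)" if "b \<in> Basis" for b
  proof -
    obtain i where "b = axis i 1" using \<open>b \<in> Basis\<close> by (auto simp: Basis_vec_def)
    then show ?thesis using assms[of i] by (simp add: inner_axis)
  qed
  then show ?thesis by (subst differentiable_componentwise_within) simp
qed

definition Ck_vec_on :: "nat \<Rightarrow> (real^2 \<Rightarrow> real^6) \<Rightarrow> (real^2) set \<Rightarrow> bool" where
  "Ck_vec_on k W N \<longleftrightarrow> (\<forall>i. Ck_on k (\<lambda>q. W q $ i) N)"

lemma Ck_vec_on_partial_nth:
  assumes "Ck_vec_on k W N" "0 < k" "p \<in> N"
  shows "partial a W p $ i = partial a (\<lambda>q. W q $ i) p"
  by (intro partial_nth differentiable_vec_componentwise)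
    (use assms in \<open>auto simp: Ck_vec_on_def intro: Ck_on_differentiable\<close>)

context projective_coefficients
begin

lemmas matrix_simps = vector_matrix_mult_def sum_6 \<Omega>1_def \<Omega>2_def vector_6

lemma Ck_vec_on_D:
  assumes W: "Ck_vec_on (Suc k) W N" and k: "k \<le> 2"
  shows "Ck_vec_on k (D1 \<Gamma> W) N" and "Ck_vec_on k (D2 \<Gamma> W) N"
proof -
  have Wi: "Ck_on k (\<lambda>q. W q $ i) N" for i
    using W Ck_on_SucD unfolding Ck_vec_on_def by blast
  have dW: "Ck_on k (\<lambda>q. partial a W q $ i) N" for a i
    by (rule Ck_on_cong[OF open_N, of "partial a (\<lambda>q. W q $ i)"])
      (use W Ck_vec_on_partial_nth[OF W] in \<open>auto simp: Ck_vec_on_def\<close>)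
  note coef = Ck_coefficients[THEN Ck_on_mono[rotated], of k] C5[THEN Ck_on_mono[rotated], of k]
  show "Ck_vec_on k (D1 \<Gamma> W) N"
    unfolding Ck_vec_on_def forall_6 D1_def matrix_simps vector_minus_component vec_lambda_beta
    using k by (intro conjI Ck_intros open_N dW Wi coef) auto
  show "Ck_vec_on k (D2 \<Gamma> W) N"
    unfolding Ck_vec_on_def forall_6 D2_def matrix_simps vector_minus_component vec_lambda_beta
    using k by (intro conjI Ck_intros open_N dW Wi coef) auto
qed

lemma Ck_vec_on_\<V>: "Ck_vec_on 2 (\<V> \<Gamma>) N"
proof -
  have dL: "Ck_on 2 (partial a (L1 \<Gamma>)) N" "Ck_on 2 (partial a (L2 \<Gamma>)) N" for a
    using Ck_L by (auto simp: eval_nat_numeral simp del: Ck_on.simps intro: Ck_on_partial)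
  show ?thesis
    unfolding Ck_vec_on_def forall_6 \<V>_def vector_6
    by (intro conjI Ck_intros open_N dL Ck_L[THEN Ck_on_mono[rotated]] C5[THEN Ck_on_mono[rotated]]) auto
qed

end

section \<open>The kernel vector of the matrix\<close>

context liouville_solution
begin

definition \<Psi> :: "real^2 \<Rightarrow> real^6" where
  "\<Psi> p = vector [\<psi>1 p, \<psi>2 p, \<psi>3 p, \<mu> p, \<nu> p, \<rho> p]"

text \<open>The closed system expresses both derivatives of \<rho> through C^1 functions. One order
  is thus gained, and the second derivatives of \<rho> commute.\<close>

lemma C2_\<rho>: "Ck_on 2 \<rho> N"
proof -
  have "Ck_on 1 (partial 1 \<rho>) N"
    by (rule Ck_on_cong[OF open_N \<rho>_x[symmetric]], assumption)
      (intro Ck_intros open_N C1_\<psi> C1_\<mu> C1_\<nu> C1_\<rho>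
        Ck_coefficients[THEN Ck_on_mono[rotated]] C5[THEN Ck_on_mono[rotated]]; simp)
  moreover have "Ck_on 1 (partial 2 \<rho>) N"
    by (rule Ck_on_cong[OF open_N \<rho>_y[symmetric]], assumption)
      (intro Ck_intros open_N C1_\<psi> C1_\<mu> C1_\<nu> C1_\<rho>
        Ck_coefficients[THEN Ck_on_mono[rotated]] C5[THEN Ck_on_mono[rotated]]; simp)
  ultimately have "Ck_on 1 (partial a \<rho>) N" for a using exhaust_2[of a] by auto
  then show ?thesis using C1_\<rho> by (simp add: numeral_2_eq_2)
qed

text \<open>Cross-differentiating the two equations for \<rho> gives the last row of the curvature
  paired with \<Psi>, and this vanishes by symmetry of second derivatives.\<close>

lemma \<V>_annihilates_\<Psi>:
  assumes p: "p \<in> N"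
  shows "\<V> \<Gamma> p \<bullet> \<Psi> p = 0"
proof -
  note diff = \<Psi>_differentiable[OF p] Ck_on_differentiable[OF C1_\<rho> _ p, simplified]
    coefficients_differentiable[OF p] jets_differentiable[OF p]
  have \<rho>_simps: "partial 2 \<mu> p = \<rho> p" by (simp add: \<rho>_def)
  have "partial 2 (partial 1 \<rho>) p
    = partial 2 (\<lambda>q. - (a61 \<Gamma> q * \<psi>1 q + a62 \<Gamma> q * \<psi>2 q + a63 \<Gamma> q * \<psi>3 q + a64 \<Gamma> q * \<mu> q + a65 \<Gamma> q * \<nu> q
    - 1/3 * A1 \<Gamma> q * \<rho> q)) p"
    by (rule partial_cong[OF open_N p \<rho>_x])
  also have "\<dots> = - (partial 2 (a61 \<Gamma>) p * \<psi>1 p + a61 \<Gamma> p * partial 2 \<psi>1 p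
     + (partial 2 (a62 \<Gamma>) p * \<psi>2 p + a62 \<Gamma> p * partial 2 \<psi>2 p)
     + (partial 2 (a63 \<Gamma>) p * \<psi>3 p + a63 \<Gamma> p * partial 2 \<psi>3 p)
     + (partial 2 (a64 \<Gamma>) p * \<mu> p + a64 \<Gamma> p * \<rho> p)
     + (partial 2 (a65 \<Gamma>) p * \<nu> p + a65 \<Gamma> p * \<nu>y p)
     - 1/3 * (partial 2 (A1 \<Gamma>) p * \<rho> p + A1 \<Gamma> p * partial 2 \<rho> p))"
    by (simp add: partial_simps diff \<rho>_simps \<nu>_y p)
  finally have 1: "partial 2 (partial 1 \<rho>) p = \<dots>" .
  have "partial 1 (partial 2 \<rho>) p
    = partial 1 (\<lambda>q. - (b61 \<Gamma> q * \<psi>1 q + b62 \<Gamma> q * \<psi>2 q + b63 \<Gamma> q * \<psi>3 q + b64 \<Gamma> q * \<mu> q + b65 \<Gamma> q * \<nu> q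
    + 1/3 * A2 \<Gamma> q * \<rho> q)) p"
    by (rule partial_cong[OF open_N p \<rho>_y])
  also have "\<dots> = - (partial 1 (b61 \<Gamma>) p * \<psi>1 p + b61 \<Gamma> p * partial 1 \<psi>1 p
     + (partial 1 (b62 \<Gamma>) p * \<psi>2 p + b62 \<Gamma> p * partial 1 \<psi>2 p)
     + (partial 1 (b63 \<Gamma>) p * \<psi>3 p + b63 \<Gamma> p * partial 1 \<psi>3 p)
     + (partial 1 (b64 \<Gamma>) p * \<mu> p + b64 \<Gamma> p * \<mu>x p)
     + (partial 1 (b65 \<Gamma>) p * \<nu> p + b65 \<Gamma> p * \<rho> p)
     + 1/3 * (partial 1 (A2 \<Gamma>) p * \<rho> p + A2 \<Gamma> p * partial 1 \<rho> p))"
    by (simp add: partial_simps diff \<mu>_x \<nu>_x p)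
  finally have 2: "partial 1 (partial 2 \<rho>) p = \<dots>" .
  \<comment> \<open>The sixth column of the curvature row vanishes, in accordance with the last
    entry 0 of \<open>\<V>\<close>.\<close>
  have c6: "a64 \<Gamma> p - 1/3 * partial 2 (A1 \<Gamma>) p = b65 \<Gamma> p + 1/3 * partial 1 (A2 \<Gamma>) p"
    by (simp add: a64_def b65_def)
  have "(- \<V> \<Gamma> p $ 1) * \<psi>1 p + (- \<V> \<Gamma> p $ 2) * \<psi>2 p + (- \<V> \<Gamma> p $ 3) * \<psi>3 p
      + (- \<V> \<Gamma> p $ 4) * \<mu> p + (- \<V> \<Gamma> p $ 5) * \<nu> p
      + (a64 \<Gamma> p - 1/3 * partial 2 (A1 \<Gamma>) p - (b65 \<Gamma> p + 1/3 * partial 1 (A2 \<Gamma>) p)) * \<rho> p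
      = partial 1 (partial 2 \<rho>) p - partial 2 (partial 1 \<rho>) p"
    unfolding 1 2 curvature_1[OF p, symmetric] curvature_2[OF p, symmetric] curvature_3[OF p, symmetric]
      curvature_4[OF p, symmetric] curvature_5[OF p, symmetric] \<psi>_partial[OF p] \<rho>_x[OF p] \<rho>_y[OF p] \<mu>x_def \<nu>y_def
    by (simp add: field_simps)
  also have "\<dots> = 0" using partial_commute[OF open_N p C2_\<rho>] by simp
  finally have "\<V> \<Gamma> p $ 1 * \<psi>1 p + \<V> \<Gamma> p $ 2 * \<psi>2 p + \<V> \<Gamma> p $ 3 * \<psi>3 p
      + \<V> \<Gamma> p $ 4 * \<mu> p + \<V> \<Gamma> p $ 5 * \<nu> p = 0" using c6 by (simp add: algebra_simps)
  moreover have "\<V> \<Gamma> p $ 6 = 0" by (simp add: \<V>_def vector_6)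
  ultimately show ?thesis by (simp add: inner_vec_def sum_6 \<Psi>_def vector_6)
qed

text \<open>\<open>\<Psi>\<close> is parallel: \<open>\<partial>\<^sub>a \<Psi> = - \<Omega>\<^sub>a \<Psi>\<close>, so \<open>D\<^sub>a W \<cdot> \<Psi> = \<partial>\<^sub>a (W \<cdot> \<Psi>)\<close>.\<close>
lemma D_annihilates_\<Psi>:
  assumes W: "Ck_vec_on (Suc k) W N" and ann: "\<And>q. q \<in> N \<Longrightarrow> W q \<bullet> \<Psi> q = 0" and p: "p \<in> N"
  shows "D1 \<Gamma> W p \<bullet> \<Psi> p = 0" and "D2 \<Gamma> W p \<bullet> \<Psi> p = 0"
proof -
  have dW: "(\<lambda>q. W q $ i) differentiable (at p)" for i
    using W Ck_on_differentiable[OF _ _ p, of "Suc k"] by (simp add: Ck_vec_on_def)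
  note nth = Ck_vec_on_partial_nth[OF W _ p, simplified]
  note diff = dW \<Psi>_differentiable[OF p] Ck_on_differentiable[OF C1_\<rho> _ p, simplified]
  \<comment> \<open>The pairing vanishes on all of the open set \<open>N\<close>, so its derivative
    vanishes too.\<close>
  have "partial a (\<lambda>q. W q $ 1 * \<psi>1 q + W q $ 2 * \<psi>2 q + W q $ 3 * \<psi>3 q + W q $ 4 * \<mu> q + W q $ 5 * \<nu> q + W q $ 6 * \<rho> q) p
      = partial a (\<lambda>q. 0) p" for a
    by (rule partial_cong[OF open_N p]) (use ann in \<open>simp add: inner_vec_def sum_6 \<Psi>_def vector_6\<close>)
  then have sum: "partial a W p $ 1 * \<psi>1 p + W p $ 1 * partial a \<psi>1 p + (partial a W p $ 2 * \<psi>2 p + W p $ 2 * partial a \<psi>2 p)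
      + (partial a W p $ 3 * \<psi>3 p + W p $ 3 * partial a \<psi>3 p) + (partial a W p $ 4 * \<mu> p + W p $ 4 * partial a \<mu> p)
      + (partial a W p $ 5 * \<nu> p + W p $ 5 * partial a \<nu> p) + (partial a W p $ 6 * \<rho> p + W p $ 6 * partial a \<rho> p) = 0" for a
    by (simp add: partial_simps diff nth)
  show "D1 \<Gamma> W p \<bullet> \<Psi> p = 0"
    using sum[of 1]
    by (simp add: D1_def inner_vec_def matrix_simps \<Psi>_def \<psi>_partial[OF p] \<mu>_x[OF p] \<nu>_x[OF p] \<rho>_x[OF p] \<mu>x_def)
      (simp add: algebra_simps)
  have "partial 2 \<mu> p = \<rho> p" by (simp add: \<rho>_def)
  then show "D2 \<Gamma> W p \<bullet> \<Psi> p = 0"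
    using sum[of 2]
    by (simp add: D2_def inner_vec_def matrix_simps \<Psi>_def \<psi>_partial[OF p] \<nu>_y[OF p] \<rho>_y[OF p] \<nu>y_def)
      (simp add: algebra_simps)
qed

text \<open>\<open>\<V>\<close> is C^2 and its first covariant derivatives are C^1, so
  \<open>D_annihilates_\<Psi>\<close> applies twice. The symmetrised row follows by linearity, and
  \<Psi> is a nonzero kernel vector.\<close>

lemma det_\<M>_eq_0:
  assumes p: "p \<in> N" and nz: "\<psi>1 p \<noteq> 0 \<or> \<psi>2 p \<noteq> 0 \<or> \<psi>3 p \<noteq> 0"
  shows "det (\<M> \<Gamma> p) = 0"
proof -
  note C2 = Ck_vec_on_\<V>[unfolded numeral_2_eq_2] and ann0 = \<V>_annihilates_\<Psi>
  note C1 = Ck_vec_on_D[OF C2, simplified]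
  have ann1: "D1 \<Gamma> (\<V> \<Gamma>) q \<bullet> \<Psi> q = 0" "D2 \<Gamma> (\<V> \<Gamma>) q \<bullet> \<Psi> q = 0" if "q \<in> N" for q
    using D_annihilates_\<Psi>[OF C2 _ that] ann0 by blast+
  have ann2: "D1 \<Gamma> (D1 \<Gamma> (\<V> \<Gamma>)) p \<bullet> \<Psi> p = 0" "D1 \<Gamma> (D2 \<Gamma> (\<V> \<Gamma>)) p \<bullet> \<Psi> p = 0"
     "D2 \<Gamma> (D1 \<Gamma> (\<V> \<Gamma>)) p \<bullet> \<Psi> p = 0" "D2 \<Gamma> (D2 \<Gamma> (\<V> \<Gamma>)) p \<bullet> \<Psi> p = 0"
    using D_annihilates_\<Psi>[OF C1(1) _ p] D_annihilates_\<Psi>[OF C1(2) _ p] ann1 by blast+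
  have "\<forall>i. \<M> \<Gamma> p $ i \<bullet> \<Psi> p = 0"
    unfolding forall_6 \<M>_def vector_6 using ann0[OF p] ann1[OF p] ann2
    by (simp add: inner_add_left)
  then have "\<M> \<Gamma> p *v \<Psi> p = 0" by (simp add: vec_eq_iff matrix_vector_mul_component)
  moreover have "\<Psi> p \<noteq> 0" using nz by (auto simp: vec_eq_iff forall_6 \<Psi>_def vector_6)
  ultimately show ?thesis
    using matrix_left_invertible_ker[of "\<M> \<Gamma> p"] invertible_det_nz[of "\<M> \<Gamma> p"] invertible_left_inverse[of "\<M> \<Gamma> p"]
    by blast
qed

end

section \<open>Liouville's system of a metric\<close>

text \<open>Lowering the upper index cancels \<open>matrix_inv\<close> and leaves Christoffel
  symbols of the first kind, so later computations avoid the inverse metric.\<close>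

lemma levi_civita_lowered:
  assumes "det (g p) \<noteq> 0"
  shows "g p $ c $ 1 * levi_civita g p 1 a b + g p $ c $ 2 * levi_civita g p 2 a b
    = 1/2 * (partial a (\<lambda>q. g q $ b $ c) p + partial b (\<lambda>q. g q $ a $ c) p - partial c (\<lambda>q. g q $ a $ b) p)"
proof -
  have "\<exists>B. g p ** B = mat 1 \<and> B ** g p = mat 1"
    using assms by (simp add: invertible_det_nz[symmetric] invertible_def)
  then have inv: "g p ** matrix_inv (g p) = mat 1"
    unfolding matrix_inv_def by (rule someI2_ex) simp
  define w :: "real^2" where "w = (\<chi> d. 1/2 * (partial a (\<lambda>q. g q $ b $ d) p
    + partial b (\<lambda>q. g q $ a $ d) p - partial d (\<lambda>q. g q $ a $ b) p))"
  have "levi_civita g p e a b = (matrix_inv (g p) *v w) $ e" for e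
    by (simp add: levi_civita_def matrix_vector_mult_def w_def sum_2 algebra_simps)
  then have "g p $ c $ 1 * levi_civita g p 1 a b + g p $ c $ 2 * levi_civita g p 2 a b
      = (g p *v (matrix_inv (g p) *v w)) $ c"
    by (simp add: matrix_vector_mult_def[of "g p"] sum_2)
  also have "\<dots> = w $ c"
    by (simp add: matrix_vector_mul_assoc inv)
  finally show ?thesis by (simp add: w_def)
qed

text \<open>The contributions of \<omega> cancel in each combination, so the coefficients may be
  read off from the Levi-Civita connection.\<close>

lemma projective_coefficients_invariant:
  assumes "projectively_equivalent_on N \<Gamma> \<Gamma>'" "p \<in> N"
  shows "A0 \<Gamma> p = - \<Gamma>' p 2 1 1" "A1 \<Gamma> p = \<Gamma>' p 1 1 1 - 2 * \<Gamma>' p 2 1 2"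
    "A2 \<Gamma> p = 2 * \<Gamma>' p 1 1 2 - \<Gamma>' p 2 2 2" "A3 \<Gamma> p = \<Gamma>' p 1 2 2"
proof -
  obtain \<omega> :: "real^2 \<Rightarrow> real^2" where "\<And>a b c. \<Gamma>' p c a b = \<Gamma> p c a b + kronecker c a * \<omega> p $ b + kronecker c b * \<omega> p $ a"
    using assms unfolding projectively_equivalent_on_def by blast
  then show "A0 \<Gamma> p = - \<Gamma>' p 2 1 1" "A1 \<Gamma> p = \<Gamma>' p 1 1 1 - 2 * \<Gamma>' p 2 1 2"
    "A2 \<Gamma> p = 2 * \<Gamma>' p 1 1 2 - \<Gamma>' p 2 2 2" "A3 \<Gamma> p = \<Gamma>' p 1 2 2"
    by (simp_all add: A0_def A1_def A2_def A3_def kronecker_def)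
qed

text \<open>Weighting the metric by \<open>(det g)\<^sup>2 powr (- 1/3)\<close>, that is by \<open>\<bar>det g\<bar>\<close> to the power \<open>- 2/3\<close>,
  makes Liouville's system linear; the square covers both signatures.\<close>
lemma liouville_solution_of_metric:
  fixes g :: "real^2 \<Rightarrow> real^2^2"
  defines "\<phi> \<equiv> \<lambda>p. (det (g p))\<^sup>2 powr (- 1/3)"
  assumes coef: "projective_coefficients \<Gamma> N"
    and g: "metric_on N g" and eq: "projectively_equivalent_on N \<Gamma> (levi_civita g)"
  shows "liouville_solution \<Gamma> N (\<lambda>p. g p $ 1 $ 1 * \<phi> p) (\<lambda>p. g p $ 1 $ 2 * \<phi> p) (\<lambda>p. g p $ 2 $ 2 * \<phi> p)"
proof -
  interpret projective_coefficients \<Gamma> N by (rule coef)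
  define E F G where "E = (\<lambda>p. g p $ 1 $ 1)" and "F = (\<lambda>p. g p $ 1 $ 2)" and "G = (\<lambda>p. g p $ 2 $ 2)"
  define \<Delta> where "\<Delta> = (\<lambda>p. E p * G p - (F p)\<^sup>2)"
  have sym: "g p $ 2 $ 1 = F p" if "p \<in> N" for p
  proof -
    have "transpose (g p) = g p" using g that unfolding metric_on_def by blast
    then have "transpose (g p) $ 1 $ 2 = g p $ 1 $ 2" by (rule arg_cong)
    then show ?thesis by (simp add: transpose_def F_def)
  qed
  have det: "det (g p) = \<Delta> p" if "p \<in> N" for p
    using sym[OF that] by (simp add: det_2 \<Delta>_def E_def F_def G_def power2_eq_square)
  have \<Delta>0: "\<Delta> p \<noteq> 0" if "p \<in> N" for p
    using g det[OF that] that unfolding metric_on_def by auto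
  have C1: "Ck_on 1 E N" "Ck_on 1 F N" "Ck_on 1 G N"
    using g unfolding metric_on_def E_def F_def G_def by blast+
  have diff: "E differentiable (at p)" "F differentiable (at p)" "G differentiable (at p)" if "p \<in> N" for p
    using C1 that by simp_all
  have F': "partial a (\<lambda>q. g q $ 2 $ 1) p = partial a F p" if "p \<in> N" for a p
    by (rule partial_cong[OF open_N that]) (rule sym)
  let ?K = "levi_civita g"
  have lc: "E p * ?K p 1 1 1 + F p * ?K p 2 1 1 = 1/2 * partial 1 E p"
      "F p * ?K p 1 1 1 + G p * ?K p 2 1 1 = partial 1 F p - 1/2 * partial 2 E p"
      "E p * ?K p 1 1 2 + F p * ?K p 2 1 2 = 1/2 * partial 2 E p"
      "F p * ?K p 1 1 2 + G p * ?K p 2 1 2 = 1/2 * partial 1 G p"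
      "E p * ?K p 1 2 2 + F p * ?K p 2 2 2 = partial 2 F p - 1/2 * partial 1 G p"
      "F p * ?K p 1 2 2 + G p * ?K p 2 2 2 = 1/2 * partial 2 G p" if "p \<in> N" for p
  proof -
    note * = levi_civita_lowered[of g p, unfolded det[OF that], OF \<Delta>0[OF that]]
    note ** = F'[OF that, unfolded F_def] sym[OF that, unfolded F_def]
    show "E p * ?K p 1 1 1 + F p * ?K p 2 1 1 = 1/2 * partial 1 E p"
      "F p * ?K p 1 1 1 + G p * ?K p 2 1 1 = partial 1 F p - 1/2 * partial 2 E p"
      "E p * ?K p 1 1 2 + F p * ?K p 2 1 2 = 1/2 * partial 2 E p"
      "F p * ?K p 1 1 2 + G p * ?K p 2 1 2 = 1/2 * partial 1 G p"
      "E p * ?K p 1 2 2 + F p * ?K p 2 2 2 = partial 2 F p - 1/2 * partial 1 G p"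
      "F p * ?K p 1 2 2 + G p * ?K p 2 2 2 = 1/2 * partial 2 G p"
      unfolding E_def F_def G_def
      using *[of 1 1 1] *[of 2 1 1] *[of 1 1 2] *[of 2 1 2] *[of 1 2 2] *[of 2 2 2]
      by (simp_all add: **)
  qed
  note inv = projective_coefficients_invariant[OF eq]
  \<comment> \<open>The chain rule for the -1/3 power of the square of \<Delta>.\<close>
  define \<phi>' where "\<phi>' = (\<lambda>a p. - 2/3 * \<phi> p * partial a \<Delta> p / \<Delta> p)"
  have \<phi>: "\<phi> p = (\<Delta> p)\<^sup>2 powr (- 1/3)" if "p \<in> N" for p using det[OF that] by (simp add: \<phi>_def)
  have C1\<Delta>: "Ck_on 1 \<Delta> N" unfolding \<Delta>_def by (intro Ck_intros open_N C1)
  have d\<phi>: "has_partial a \<phi> (\<phi>' a p) p" if p: "p \<in> N" for a p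
  proof -
    have pos: "(\<Delta> p)\<^sup>2 > 0" using \<Delta>0[OF p] by simp
    have "has_partial a (\<lambda>q. (\<Delta> q)\<^sup>2 powr (- 1/3)) ((- 1/3) * (\<Delta> p)\<^sup>2 powr (- 1/3 - 1) * (2 * \<Delta> p * partial a \<Delta> p)) p"
      using C1\<Delta> p pos by (intro has_partial_powr has_partial_square has_partial_partial) auto
    moreover have "(- 1/3) * (\<Delta> p)\<^sup>2 powr (- 1/3 - 1) * (2 * \<Delta> p * partial a \<Delta> p) = \<phi>' a p"
      unfolding \<phi>'_def \<phi>[OF p] powr_diff using pos \<Delta>0[OF p] by (simp add: field_simps power2_eq_square)
    ultimately show ?thesis
      using has_partial_cong[OF open_N p, of "\<lambda>q. (\<Delta> q)\<^sup>2 powr (- 1/3)" \<phi>] \<phi> by simp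
  qed
  have c\<phi>: "continuous_on N \<phi>"
  proof -
    have "continuous_on N (\<lambda>q. (\<Delta> q)\<^sup>2 powr (- 1/3))"
      using \<Delta>0 C1\<Delta>[THEN Ck_on_imp_continuous] by (intro continuous_intros) auto
    then show ?thesis using \<phi> by (simp cong: continuous_on_cong)
  qed
  have c\<phi>': "continuous_on N (\<phi>' a)" for a
    unfolding \<phi>'_def using \<Delta>0 C1\<Delta> C1\<Delta>[THEN Ck_on_imp_continuous] by (intro continuous_intros c\<phi>) auto
  have C1\<phi>: "Ck_on 1 \<phi> N" by (rule C1_from_partials[OF open_N d\<phi> d\<phi> c\<phi>' c\<phi>'])
  have \<phi>_diff: "\<phi> differentiable (at p)" if "p \<in> N" for p using C1\<phi> that by simp
  have \<phi>_partial: "partial 1 \<phi> p = - 4/3 * \<phi> p * (?K p 1 1 1 + ?K p 2 1 2)"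
      "partial 2 \<phi> p = - 4/3 * \<phi> p * (?K p 1 1 2 + ?K p 2 2 2)" if p: "p \<in> N" for p
  proof -
    have \<Delta>': "partial a \<Delta> p = partial a E p * G p + E p * partial a G p - 2 * F p * partial a F p" for a
      unfolding \<Delta>_def using diff[OF p] by (simp add: partial_simps)
    \<comment> \<open>The logarithmic derivative of the determinant is twice the contracted
      connection, which yields the factor -4/3 for \<phi>.\<close>
    have "partial 1 \<Delta> p = 2 * \<Delta> p * (?K p 1 1 1 + ?K p 2 1 2)" "partial 2 \<Delta> p = 2 * \<Delta> p * (?K p 1 1 2 + ?K p 2 2 2)"
      unfolding \<Delta>' using lc[OF p] unfolding \<Delta>_def power2_eq_square by algebra+
    then show "partial 1 \<phi> p = - 4/3 * \<phi> p * (?K p 1 1 1 + ?K p 2 1 2)"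
      "partial 2 \<phi> p = - 4/3 * \<phi> p * (?K p 1 1 2 + ?K p 2 2 2)"
      using has_partial_imp_partial[OF \<phi>_diff[OF p] d\<phi>[OF p]] \<Delta>0[OF p] by (simp_all add: \<phi>'_def)
  qed
  have "liouville_solution \<Gamma> N (\<lambda>p. E p * \<phi> p) (\<lambda>p. F p * \<phi> p) (\<lambda>p. G p * \<phi> p)"
  proof unfold_locales
    show "Ck_on 1 (\<lambda>p. E p * \<phi> p) N" "Ck_on 1 (\<lambda>p. F p * \<phi> p) N" "Ck_on 1 (\<lambda>p. G p * \<phi> p) N"
      by (intro Ck_intros open_N C1 C1\<phi>)+
    fix p assume p: "p \<in> N"
    \<comment> \<open>The metric is covariantly constant; these are its partial derivatives solved
      from that condition.\<close>
    have E: "partial 1 E p = 2 * (E p * ?K p 1 1 1 + F p * ?K p 2 1 1)"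
      "partial 2 E p = 2 * (E p * ?K p 1 1 2 + F p * ?K p 2 1 2)"
      "partial 1 G p = 2 * (F p * ?K p 1 1 2 + G p * ?K p 2 1 2)"
      "partial 2 G p = 2 * (F p * ?K p 1 2 2 + G p * ?K p 2 2 2)"
      "partial 1 F p = F p * ?K p 1 1 1 + G p * ?K p 2 1 1 + E p * ?K p 1 1 2 + F p * ?K p 2 1 2"
      "partial 2 F p = E p * ?K p 1 2 2 + F p * ?K p 2 2 2 + F p * ?K p 1 1 2 + G p * ?K p 2 1 2"
      using lc[OF p] by simp_all
    \<comment> \<open>With these substitutions each equation becomes a polynomial identity in the
      metric entries, \<phi> and the connection components.\<close>
    note expand = partial_mult \<phi>_partial[OF p] E inv[OF p] \<phi>_diff[OF p] diff[OF p]
    show "partial 1 (\<lambda>p. E p * \<phi> p) p = 2/3 * A1 \<Gamma> p * (E p * \<phi> p) - 2 * A0 \<Gamma> p * (F p * \<phi> p)"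
      "partial 2 (\<lambda>p. G p * \<phi> p) p = 2 * A3 \<Gamma> p * (F p * \<phi> p) - 2/3 * A2 \<Gamma> p * (G p * \<phi> p)"
      "partial 2 (\<lambda>p. E p * \<phi> p) p + 2 * partial 1 (\<lambda>p. F p * \<phi> p) p
        = 4/3 * A2 \<Gamma> p * (E p * \<phi> p) - 2/3 * A1 \<Gamma> p * (F p * \<phi> p) - 2 * A0 \<Gamma> p * (G p * \<phi> p)"
      "partial 1 (\<lambda>p. G p * \<phi> p) p + 2 * partial 2 (\<lambda>p. F p * \<phi> p) p
        = 2 * A3 \<Gamma> p * (E p * \<phi> p) - 4/3 * A1 \<Gamma> p * (G p * \<phi> p) + 2/3 * A2 \<Gamma> p * (F p * \<phi> p)"
      by (simp_all add: expand field_simps)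
  qed
  then show ?thesis by (simp add: E_def F_def G_def)
qed

theorem theorem1p1:
  fixes U :: "(real^2) set" and \<Gamma> :: connection
  assumes "open U"
    and "torsion_free_on U \<Gamma>"
    and "Ck_on 5 (A0 \<Gamma>) U" "Ck_on 5 (A1 \<Gamma>) U" "Ck_on 5 (A2 \<Gamma>) U" "Ck_on 5 (A3 \<Gamma>) U"
    and "\<forall>p\<in>U. metrisable_near U \<Gamma> p"
  shows "\<forall>p\<in>U. det (\<M> \<Gamma> p) = 0"
proof
  fix p assume "p \<in> U"
  then obtain N g where N: "open N" "p \<in> N" "N \<subseteq> U" and g: "metric_on N g"
    and lc: "levi_civita g \<in> projective_class N \<Gamma>"
    using assms(7) unfolding metrisable_near_def by blast
  let ?\<phi> = "\<lambda>p. (det (g p))\<^sup>2 powr (- 1/3)"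
  have "projective_coefficients \<Gamma> N"
    using N assms(3-6) by unfold_locales (blast intro: Ck_on_subset)+
  then interpret liouville_solution \<Gamma> N "\<lambda>p. g p $ 1 $ 1 * ?\<phi> p" "\<lambda>p. g p $ 1 $ 2 * ?\<phi> p" "\<lambda>p. g p $ 2 $ 2 * ?\<phi> p"
    using liouville_solution_of_metric g lc unfolding projective_class_def by blast
  have "transpose (g p) = g p" and nz: "det (g p) \<noteq> 0"
    using g N unfolding metric_on_def by auto
  then have "transpose (g p) $ 1 $ 2 = g p $ 1 $ 2" by simp
  then have "g p $ 2 $ 1 = g p $ 1 $ 2" by (simp add: transpose_def)
  \<comment> \<open>If all three entries vanished, the symmetric matrix would be zero. The factor
    \<open>?\<phi> p\<close> is nonzero as a power of a positive number, so the weighted entries do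
    not all vanish either.\<close>
  then have "g p $ 1 $ 1 \<noteq> 0 \<or> g p $ 1 $ 2 \<noteq> 0 \<or> g p $ 2 $ 2 \<noteq> 0"
    using nz by (auto simp: det_2)
  then show "det (\<M> \<Gamma> p) = 0"
    using nz by (intro det_\<M>_eq_0 N) auto
qed

end
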